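(* Let $K/F$ be a finite Galois $2$-extension of formally real fields that is totally positive. Let $(A,\sigma)$ be a central simple algebra over $F$ with an orthogonal involution $\sigma$. If $\sigma_K=\sigma\otimes 1_K$ on $A\otimes_F K$ is weakly isotropic, then $\sigma$ is weakly isotropic over $F$.
   Context: A field is formally real if $-1$ is not a sum of squares in it. A finite Galois $2$-extension is a finite Galois extension whose Galois group is a $2$-group. A semiordering on a field $F$ is a subset $S\subset F$ with $1\in S$, $F^2S\subset S$, $S+S\subset S$, $S\cup -S=F$ and $S\cap -S=\{0\}$. An extension $K/F$ of formally real fields is totally positive if every semiordering $S$ on $F$ extends to a semiordering $S'$ on $K$ (i.e. $S'\cap F=S$). An involution (of the first kind) on a central simple $F$-algebra $A$ is an $F$-linear anti-automorphism $\sigma$ of $A$ with $\sigma\circ\sigma=\mathrm{id}$. It is orthogonal if for any splitting field $L$ and any isomorphism $(A\otimes_F L,\sigma\otimes 1_L)\simeq(\mathrm{End}_L(V),\sigma_b)$, where $\sigma_b$ is the adjoint involution of a nonsingular bilinear form $b$ (i.e. $b(x,f(y))=b(\sigma_b(f)(x),y)$), the form $b$ is symmetric. The involution $\sigma$ is weakly isotropic if there exist $n\ge 1$ and nonzero $x_1,\dots,x_n\in A$ with $\sum_{i=1}^n\sigma(x_i)x_i=0$. *)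

theory Defs
  imports "HOL-Algebra.Algebra" "Jordan_Normal_Form.Missing_VectorSpace"
begin

section \<open>Formally real fields, semiorderings, Galois 2-extensions\<close>

definition formally_real :: "('a, 'm) ring_scheme \<Rightarrow> bool" where
  "formally_real R \<longleftrightarrow> field R \<and>
     \<not> (\<exists>(n::nat) x. x \<in> {..<n} \<rightarrow> carrier R \<and>
          \<ominus>\<^bsub>R\<^esub> \<one>\<^bsub>R\<^esub> = (\<Oplus>\<^bsub>R\<^esub>i\<in>{..<n}. x i \<otimes>\<^bsub>R\<^esub> x i))"

definition semiordering :: "('a, 'm) ring_scheme \<Rightarrow> 'a set \<Rightarrow> bool" where
  "semiordering R S \<longleftrightarrow>
     S \<subseteq> carrier R \<and>
     \<one>\<^bsub>R\<^esub> \<in> S \<and>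
     (\<forall>x\<in>carrier R. \<forall>s\<in>S. (x \<otimes>\<^bsub>R\<^esub> x) \<otimes>\<^bsub>R\<^esub> s \<in> S) \<and>
     (\<forall>s\<in>S. \<forall>t\<in>S. s \<oplus>\<^bsub>R\<^esub> t \<in> S) \<and>
     S \<union> (\<lambda>s. \<ominus>\<^bsub>R\<^esub> s) ` S = carrier R \<and>
     S \<inter> (\<lambda>s. \<ominus>\<^bsub>R\<^esub> s) ` S = {\<zero>\<^bsub>R\<^esub>}"

text \<open>A field extension \<open>K/F\<close> is a field \<open>K\<close> with a subfield \<open>F\<close> (\<^const>\<open>subfield\<close>);
  \<open>K\<lparr>carrier := F\<rparr>\<close> is \<open>F\<close> as a field in its own right.\<close>

definition totally_positive :: "('a, 'm) ring_scheme \<Rightarrow> 'a set \<Rightarrow> bool" where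
  "totally_positive K F \<longleftrightarrow>
     subfield F K \<and> formally_real (K\<lparr>carrier := F\<rparr>) \<and> formally_real K \<and>
     (\<forall>S. semiordering (K\<lparr>carrier := F\<rparr>) S \<longrightarrow>
        (\<exists>S'. semiordering K S' \<and> S' \<inter> F = S))"

definition galois_group :: "('a, 'm) ring_scheme \<Rightarrow> 'a set \<Rightarrow> ('a \<Rightarrow> 'a) monoid" where
  "galois_group K F = (BijGroup (carrier K))
     \<lparr>carrier := {\<tau> \<in> ring_hom K K \<inter> Bij (carrier K). \<forall>x\<in>F. \<tau> x = x}\<rparr>"

definition finite_galois :: "('a, 'm) ring_scheme \<Rightarrow> 'a set \<Rightarrow> bool" where
  "finite_galois K F \<longleftrightarrow>
     field K \<and> subfield F K \<and> ring.finite_dimension K F (carrier K) \<and>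
     {x \<in> carrier K. \<forall>\<tau>\<in>carrier (galois_group K F). \<tau> x = x} = F"

definition finite_galois_2_extension :: "('a, 'm) ring_scheme \<Rightarrow> 'a set \<Rightarrow> bool" where
  "finite_galois_2_extension K F \<longleftrightarrow>
     finite_galois K F \<and> (\<exists>n::nat. order (galois_group K F) = 2 ^ n)"

section \<open>Central simple algebras and involutions\<close>

text \<open>Unlike \<^locale>\<open>algebra\<close>, the algebra need not be commutative.\<close>

locale assoc_algebra = module R A + A?: ring A
    for R (structure) and A (structure) +
  assumes smult_mult_left: "\<lbrakk>r \<in> carrier R; x \<in> carrier A; y \<in> carrier A\<rbrakk> \<Longrightarrow>
      (r \<odot>\<^bsub>A\<^esub> x) \<otimes>\<^bsub>A\<^esub> y = r \<odot>\<^bsub>A\<^esub> (x \<otimes>\<^bsub>A\<^esub> y)"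
    and smult_mult_right: "\<lbrakk>r \<in> carrier R; x \<in> carrier A; y \<in> carrier A\<rbrakk> \<Longrightarrow>
      x \<otimes>\<^bsub>A\<^esub> (r \<odot>\<^bsub>A\<^esub> y) = r \<odot>\<^bsub>A\<^esub> (x \<otimes>\<^bsub>A\<^esub> y)"

definition fd_vectorspace ::
    "('l, 'm) ring_scheme \<Rightarrow> ('l, 'v, 'n) module_scheme \<Rightarrow> bool" where
  "fd_vectorspace L V \<longleftrightarrow> vectorspace L V \<and> vectorspace.fin_dim L V"

definition central_simple_algebra ::
    "('f, 'm) ring_scheme \<Rightarrow> ('f, 'a, 'n) module_scheme \<Rightarrow> bool" where
  "central_simple_algebra F A \<longleftrightarrow>
     field F \<and> assoc_algebra F A \<and> fd_vectorspace F A \<and>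
     {z \<in> carrier A. \<forall>x\<in>carrier A. z \<otimes>\<^bsub>A\<^esub> x = x \<otimes>\<^bsub>A\<^esub> z} = (\<lambda>f. f \<odot>\<^bsub>A\<^esub> \<one>\<^bsub>A\<^esub>) ` carrier F \<and>
     carrier A \<noteq> {\<zero>\<^bsub>A\<^esub>} \<and>
     (\<forall>I. ideal I A \<longrightarrow> I = {\<zero>\<^bsub>A\<^esub>} \<or> I = carrier A)"

definition involution ::
    "('f, 'm) ring_scheme \<Rightarrow> ('f, 'a, 'n) module_scheme \<Rightarrow> ('a \<Rightarrow> 'a) \<Rightarrow> bool" where
  "involution F A \<sigma> \<longleftrightarrow>
     \<sigma> \<in> module_hom F A A \<and>
     \<sigma> \<one>\<^bsub>A\<^esub> = \<one>\<^bsub>A\<^esub> \<and>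
     (\<forall>x\<in>carrier A. \<forall>y\<in>carrier A. \<sigma> (x \<otimes>\<^bsub>A\<^esub> y) = \<sigma> y \<otimes>\<^bsub>A\<^esub> \<sigma> x) \<and>
     (\<forall>x\<in>carrier A. \<sigma> (\<sigma> x) = x)"

definition weakly_isotropic :: "('a, 'm) ring_scheme \<Rightarrow> ('a \<Rightarrow> 'a) \<Rightarrow> bool" where
  "weakly_isotropic A \<sigma> \<longleftrightarrow>
     (\<exists>(n::nat) x. n \<ge> 1 \<and> x \<in> {..<n} \<rightarrow> carrier A - {\<zero>\<^bsub>A\<^esub>} \<and>
        (\<Oplus>\<^bsub>A\<^esub>i\<in>{..<n}. \<sigma> (x i) \<otimes>\<^bsub>A\<^esub> x i) = \<zero>\<^bsub>A\<^esub>)"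

section \<open>Scalar extension\<close>

text \<open>For an \<open>F\<close>-algebra \<open>A\<close> and a field extension \<open>\<iota> : F \<rightarrow> L\<close>, the tensor product \<open>A \<otimes>\<^sub>F L\<close> is
  the free abelian group on \<open>A \<times> L\<close> modulo the subgroup generated by the relations of an
  \<open>F\<close>-balanced map. The multiplication is induced by
  \<open>(a, l) (a', l') = (a a', l l')\<close> on generators.\<close>

definition tensor_relations ::
    "('f, 'm) ring_scheme \<Rightarrow> ('f, 'a, 'n) module_scheme \<Rightarrow> ('l, 'p) ring_scheme \<Rightarrow> ('f \<Rightarrow> 'l)
      \<Rightarrow> (('a \<times> 'l) \<Rightarrow>\<^sub>0 int) set" where
  "tensor_relations F A L \<iota> =
     {frag_of (a \<oplus>\<^bsub>A\<^esub> b, l) - frag_of (a, l) - frag_of (b, l) | a b l.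
        a \<in> carrier A \<and> b \<in> carrier A \<and> l \<in> carrier L} \<union>
     {frag_of (a, l \<oplus>\<^bsub>L\<^esub> k) - frag_of (a, l) - frag_of (a, k) | a l k.
        a \<in> carrier A \<and> l \<in> carrier L \<and> k \<in> carrier L} \<union>
     {frag_of (f \<odot>\<^bsub>A\<^esub> a, l) - frag_of (a, \<iota> f \<otimes>\<^bsub>L\<^esub> l) | f a l.
        f \<in> carrier F \<and> a \<in> carrier A \<and> l \<in> carrier L}"

definition tensor_kernel ::
    "('f, 'm) ring_scheme \<Rightarrow> ('f, 'a, 'n) module_scheme \<Rightarrow> ('l, 'p) ring_scheme \<Rightarrow> ('f \<Rightarrow> 'l)
      \<Rightarrow> (('a \<times> 'l) \<Rightarrow>\<^sub>0 int) set" where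
  "tensor_kernel F A L \<iota> =
     generate (free_Abelian_group (carrier A \<times> carrier L)) (tensor_relations F A L \<iota>)"

definition free_tensor_ring ::
    "('a, 'm) ring_scheme \<Rightarrow> ('l, 'n) ring_scheme \<Rightarrow> (('a \<times> 'l) \<Rightarrow>\<^sub>0 int) ring" where
  "free_tensor_ring A L =
     \<lparr>carrier = carrier (free_Abelian_group (carrier A \<times> carrier L)),
      monoid.mult = (\<lambda>c d. frag_extend (\<lambda>(a, l).
                frag_extend (\<lambda>(b, k). frag_of (a \<otimes>\<^bsub>A\<^esub> b, l \<otimes>\<^bsub>L\<^esub> k)) d) c),
      monoid.one = frag_of (\<one>\<^bsub>A\<^esub>, \<one>\<^bsub>L\<^esub>), ring.zero = 0, ring.add = (+)\<rparr>"

definition base_change_ring ::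
    "('f, 'm) ring_scheme \<Rightarrow> ('f, 'a, 'n) module_scheme \<Rightarrow> ('l, 'p) ring_scheme \<Rightarrow> ('f \<Rightarrow> 'l)
      \<Rightarrow> (('a \<times> 'l) \<Rightarrow>\<^sub>0 int) set ring" where
  "base_change_ring F A L \<iota> = free_tensor_ring A L Quot tensor_kernel F A L \<iota>"

definition pure_tensor ::
    "('f, 'm) ring_scheme \<Rightarrow> ('f, 'a, 'n) module_scheme \<Rightarrow> ('l, 'p) ring_scheme \<Rightarrow> ('f \<Rightarrow> 'l)
      \<Rightarrow> 'a \<Rightarrow> 'l \<Rightarrow> (('a \<times> 'l) \<Rightarrow>\<^sub>0 int) set" where
  "pure_tensor F A L \<iota> a l = tensor_kernel F A L \<iota> +>\<^bsub>free_tensor_ring A L\<^esub> frag_of (a, l)"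

text \<open>\<open>A \<otimes>\<^sub>F L\<close> as an \<open>L\<close>-algebra, \<open>l\<close> acting as multiplication by \<open>1 \<otimes> l\<close>.\<close>

definition base_change ::
    "('f, 'm) ring_scheme \<Rightarrow> ('f, 'a, 'n) module_scheme \<Rightarrow> ('l, 'p) ring_scheme \<Rightarrow> ('f \<Rightarrow> 'l)
      \<Rightarrow> ('l, (('a \<times> 'l) \<Rightarrow>\<^sub>0 int) set) module" where
  "base_change F A L \<iota> = ring.extend (base_change_ring F A L \<iota>)
     (module.fields (\<lambda>l z. pure_tensor F A L \<iota> \<one>\<^bsub>A\<^esub> l \<otimes>\<^bsub>base_change_ring F A L \<iota>\<^esub> z))"

text \<open>\<open>\<sigma> \<otimes> 1\<close>: the class of \<open>\<Sum> n\<^sub>i (a\<^sub>i, l\<^sub>i)\<close> goes to the class of \<open>\<Sum> n\<^sub>i (\<sigma> a\<^sub>i, l\<^sub>i)\<close>;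
  as in \<^const>\<open>rcoset_mult\<close>, the union over representatives is the common coset.\<close>

definition base_change_map ::
    "('f, 'm) ring_scheme \<Rightarrow> ('f, 'a, 'n) module_scheme \<Rightarrow> ('l, 'p) ring_scheme \<Rightarrow> ('f \<Rightarrow> 'l)
      \<Rightarrow> ('a \<Rightarrow> 'a) \<Rightarrow> (('a \<times> 'l) \<Rightarrow>\<^sub>0 int) set \<Rightarrow> (('a \<times> 'l) \<Rightarrow>\<^sub>0 int) set" where
  "base_change_map F A L \<iota> \<sigma> z =
     (\<Union>c\<in>z. tensor_kernel F A L \<iota> +>\<^bsub>free_tensor_ring A L\<^esub>
        frag_extend (\<lambda>(a, l). frag_of (\<sigma> a, l)) c)"

section \<open>Adjoint involutions and orthogonal involutions\<close>

definition End_algebra ::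
    "('l, 'm) ring_scheme \<Rightarrow> ('l, 'v, 'n) module_scheme \<Rightarrow> ('l, 'v \<Rightarrow> 'v) module" where
  "End_algebra L V =
     \<lparr>carrier = module_hom L V V \<inter> extensional (carrier V),
      monoid.mult = compose (carrier V),
      monoid.one = (\<lambda>x\<in>carrier V. x),
      ring.zero = (\<lambda>x\<in>carrier V. \<zero>\<^bsub>V\<^esub>),
      ring.add = (\<lambda>f g. \<lambda>x\<in>carrier V. f x \<oplus>\<^bsub>V\<^esub> g x),
      smult = (\<lambda>c f. \<lambda>x\<in>carrier V. c \<odot>\<^bsub>V\<^esub> f x)\<rparr>"

definition bilinear_form ::
    "('l, 'm) ring_scheme \<Rightarrow> ('l, 'v, 'n) module_scheme \<Rightarrow> ('v \<Rightarrow> 'v \<Rightarrow> 'l) \<Rightarrow> bool" where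
  "bilinear_form L V b \<longleftrightarrow>
     (\<forall>x\<in>carrier V. \<forall>y\<in>carrier V. b x y \<in> carrier L) \<and>
     (\<forall>x\<in>carrier V. \<forall>y\<in>carrier V. \<forall>z\<in>carrier V.
        b (x \<oplus>\<^bsub>V\<^esub> y) z = b x z \<oplus>\<^bsub>L\<^esub> b y z \<and> b x (y \<oplus>\<^bsub>V\<^esub> z) = b x y \<oplus>\<^bsub>L\<^esub> b x z) \<and>
     (\<forall>c\<in>carrier L. \<forall>x\<in>carrier V. \<forall>y\<in>carrier V.
        b (c \<odot>\<^bsub>V\<^esub> x) y = c \<otimes>\<^bsub>L\<^esub> b x y \<and> b x (c \<odot>\<^bsub>V\<^esub> y) = c \<otimes>\<^bsub>L\<^esub> b x y)"

definition nonsingular_form ::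
    "('l, 'm) ring_scheme \<Rightarrow> ('l, 'v, 'n) module_scheme \<Rightarrow> ('v \<Rightarrow> 'v \<Rightarrow> 'l) \<Rightarrow> bool" where
  "nonsingular_form L V b \<longleftrightarrow>
     (\<forall>x\<in>carrier V. (\<forall>y\<in>carrier V. b x y = \<zero>\<^bsub>L\<^esub>) \<longrightarrow> x = \<zero>\<^bsub>V\<^esub>) \<and>
     (\<forall>y\<in>carrier V. (\<forall>x\<in>carrier V. b x y = \<zero>\<^bsub>L\<^esub>) \<longrightarrow> y = \<zero>\<^bsub>V\<^esub>)"

definition symmetric_form :: "('l, 'v, 'n) module_scheme \<Rightarrow> ('v \<Rightarrow> 'v \<Rightarrow> 'l) \<Rightarrow> bool" where
  "symmetric_form V b \<longleftrightarrow> (\<forall>x\<in>carrier V. \<forall>y\<in>carrier V. b x y = b y x)"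

definition adjoint_involution ::
    "('l, 'm) ring_scheme \<Rightarrow> ('l, 'v, 'n) module_scheme \<Rightarrow> ('v \<Rightarrow> 'v \<Rightarrow> 'l)
      \<Rightarrow> ('v \<Rightarrow> 'v) \<Rightarrow> 'v \<Rightarrow> 'v" where
  "adjoint_involution L V b f =
     (THE g. g \<in> carrier (End_algebra L V) \<and>
        (\<forall>x\<in>carrier V. \<forall>y\<in>carrier V. b x (f y) = b (g x) y))"

definition algebra_iso ::
    "('l, 'm) ring_scheme \<Rightarrow> ('l, 'a, 'n) module_scheme \<Rightarrow> ('l, 'b, 'p) module_scheme
      \<Rightarrow> ('a \<Rightarrow> 'b) set" where
  "algebra_iso L A B = ring_iso A B \<inter> module_hom L A B"

text \<open>The vector spaces \<open>V\<close> below are arbitrary, but live on subsets of \<open>nat \<Rightarrow> 'l\<close>, which contains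
  a copy of every finite-dimensional \<open>L\<close>-vector space.\<close>

definition is_splitting_field ::
    "('f, 'm) ring_scheme \<Rightarrow> ('f, 'a, 'n) module_scheme \<Rightarrow> 'l ring \<Rightarrow> ('f \<Rightarrow> 'l) \<Rightarrow> bool" where
  "is_splitting_field F A L \<iota> \<longleftrightarrow>
     field L \<and> \<iota> \<in> ring_hom F L \<and>
     (\<exists>V :: ('l, nat \<Rightarrow> 'l) module. fd_vectorspace L V \<and>
        algebra_iso L (base_change F A L \<iota>) (End_algebra L V) \<noteq> {})"

text \<open>A formula cannot quantify over types, so splitting fields \<open>L\<close> range over all fields with
  carrier in the type of the library's algebraic closure (\<^term>\<open>field.alg_closure F\<close>). This type
  contains an algebraic closure of \<open>F\<close>, hence a splitting field of every central simple
  \<open>F\<close>-algebra; since the type of an involution does not depend on the choice of splitting field,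
  larger universes would give the same notion.\<close>

type_synonym 'f closure_elem = "('f list \<times> nat) multiset \<Rightarrow> 'f"

definition orthogonal_involution ::
    "('f, 'm) ring_scheme \<Rightarrow> ('f, 'a, 'n) module_scheme \<Rightarrow> ('a \<Rightarrow> 'a) \<Rightarrow> bool" where
  "orthogonal_involution F A \<sigma> \<longleftrightarrow>
     involution F A \<sigma> \<and>
     (\<forall>(L :: 'f closure_elem ring) \<iota>. is_splitting_field F A L \<iota> \<longrightarrow>
        (\<forall>(V :: ('f closure_elem, nat \<Rightarrow> 'f closure_elem) module) b.
           \<forall>\<phi>\<in>algebra_iso L (base_change F A L \<iota>) (End_algebra L V).
             fd_vectorspace L V \<and> bilinear_form L V b \<and> nonsingular_form L V b \<and>
             (\<forall>z\<in>carrier (base_change F A L \<iota>).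
                \<phi> (base_change_map F A L \<iota> \<sigma> z) = adjoint_involution L V b (\<phi> z))
             \<longrightarrow> symmetric_form V b))"

end

theory Submission
  imports Defs
begin

text \<open>The trace form of a totally positive finite Galois extension \<open>K/F\<close> is a sum-of-squares form:
  \<open>Tr(k\<^sup>2) = \<Sum> \<tau>(k)\<^sup>2\<close> lies in every semiordering of \<open>K\<close>, hence in every semiordering of \<open>F\<close>, and
  the elements of \<open>F\<close> lying in all semiorderings are the sums of squares (Zorn's lemma for quadratic
  modules). Given \<open>\<Sum>\<^sub>l \<sigma>\<^sub>K(z\<^sub>l) z\<^sub>l = 0\<close>, write \<open>z\<^sub>l = \<Sum>\<^sub>i a\<^sub>l\<^sub>i \<otimes> e\<^sub>i\<close> with trace-orthogonal \<open>e\<^sub>i\<close> and apply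
  \<open>id \<otimes> Tr\<close>: the result \<open>\<Sum> Tr(e\<^sub>i\<^sup>2) \<sigma>(a\<^sub>l\<^sub>i) a\<^sub>l\<^sub>i = 0\<close> expands to a sum of hermitian squares over \<open>F\<close>.\<close>

section \<open>Sums of squares and semiorderings\<close>

inductive_set sum_squares :: "('a, 'm) ring_scheme \<Rightarrow> 'a set" for R (structure) where
  zero: "\<zero> \<in> sum_squares R"
| add: "\<lbrakk>x \<in> carrier R; s \<in> sum_squares R\<rbrakk> \<Longrightarrow> x \<otimes> x \<oplus> s \<in> sum_squares R"

definition quadratic_module :: "('a, 'm) ring_scheme \<Rightarrow> 'a set \<Rightarrow> bool" where
  "quadratic_module R M \<longleftrightarrow>
     M \<subseteq> carrier R \<and> \<one>\<^bsub>R\<^esub> \<in> M \<and>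
     (\<forall>x\<in>carrier R. \<forall>s\<in>M. (x \<otimes>\<^bsub>R\<^esub> x) \<otimes>\<^bsub>R\<^esub> s \<in> M) \<and>
     (\<forall>s\<in>M. \<forall>t\<in>M. s \<oplus>\<^bsub>R\<^esub> t \<in> M)"

context cring
begin

lemma sum_squares_closed: "s \<in> sum_squares R \<Longrightarrow> s \<in> carrier R"
  by (induction rule: sum_squares.induct) auto

lemma sum_squares_add:
  assumes "s \<in> sum_squares R" "t \<in> sum_squares R"
  shows "s \<oplus> t \<in> sum_squares R"
  using assms(1)
proof induction
  case zero
  then show ?case using assms(2) sum_squares_closed by simp
next
  case (add x s)
  then have "x \<otimes> x \<oplus> s \<oplus> t = x \<otimes> x \<oplus> (s \<oplus> t)"
    using assms(2) sum_squares_closed by (simp add: a_assoc)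
  then show ?case using add sum_squares.add by simp
qed

lemma square_in_sum_squares: "x \<in> carrier R \<Longrightarrow> x \<otimes> x \<in> sum_squares R"
  using sum_squares.add[OF _ sum_squares.zero, of x R] by simp

lemma quadratic_moduleD:
  assumes "quadratic_module R M"
  shows "M \<subseteq> carrier R" "\<one> \<in> M" "\<lbrakk>x \<in> carrier R; s \<in> M\<rbrakk> \<Longrightarrow> (x \<otimes> x) \<otimes> s \<in> M"
    "\<lbrakk>s \<in> M; t \<in> M\<rbrakk> \<Longrightarrow> s \<oplus> t \<in> M" "\<zero> \<in> M"
proof -
  show "M \<subseteq> carrier R" "\<one> \<in> M" "\<lbrakk>x \<in> carrier R; s \<in> M\<rbrakk> \<Longrightarrow> (x \<otimes> x) \<otimes> s \<in> M"
    "\<lbrakk>s \<in> M; t \<in> M\<rbrakk> \<Longrightarrow> s \<oplus> t \<in> M"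
    using assms unfolding quadratic_module_def by auto
  have "(\<zero> \<otimes> \<zero>) \<otimes> \<one> \<in> M"
    using assms zero_closed unfolding quadratic_module_def by blast
  then show "\<zero> \<in> M" by simp
qed

lemma quadratic_module_sum_squares_mult:
  assumes M: "quadratic_module R M" and s: "s \<in> sum_squares R" and m: "m \<in> M"
  shows "s \<otimes> m \<in> M"
  using s
proof induction
  case zero
  show ?case using quadratic_moduleD(1,5)[OF M] m by auto
next
  case (add x s)
  have "(x \<otimes> x \<oplus> s) \<otimes> m = (x \<otimes> x) \<otimes> m \<oplus> s \<otimes> m"
    using add sum_squares_closed m quadratic_moduleD(1)[OF M] by (auto simp: l_distr)
  then show ?case using add quadratic_moduleD(3,4)[OF M] m by simp
qed

lemma quadratic_module_sum_squares: "quadratic_module R (sum_squares R)"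
proof -
  have "(x \<otimes> x) \<otimes> s \<in> sum_squares R" if x: "x \<in> carrier R" and s: "s \<in> sum_squares R" for x s
    using s
  proof induction
    case zero
    show ?case using x sum_squares.zero by simp
  next
    case (add y s)
    have "(x \<otimes> x) \<otimes> (y \<otimes> y \<oplus> s) = (x \<otimes> y) \<otimes> (x \<otimes> y) \<oplus> (x \<otimes> x) \<otimes> s"
      using x add sum_squares_closed[of s] by algebra
    then show ?case using sum_squares.add[of "x \<otimes> y" R] add x by simp
  qed
  then show ?thesis
    unfolding quadratic_module_def
    using sum_squares_closed sum_squares_add square_in_sum_squares[of \<one>] by auto
qed

lemmas sum_squares_mult = quadratic_module_sum_squares_mult[OF quadratic_module_sum_squares]

definition adjoin :: "'a set \<Rightarrow> 'a \<Rightarrow> 'a set" where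
  "adjoin M x = {m \<oplus> x \<otimes> t | m t. m \<in> M \<and> t \<in> sum_squares R}"

lemma quadratic_module_adjoin:
  assumes M: "quadratic_module R M" and x: "x \<in> carrier R"
  shows "quadratic_module R (adjoin M x)" "M \<subseteq> adjoin M x" "x \<in> adjoin M x"
proof -
  note MD = quadratic_moduleD[OF M] and TD = quadratic_moduleD[OF quadratic_module_sum_squares]
  show MN: "M \<subseteq> adjoin M x"
  proof
    fix m assume m: "m \<in> M"
    then have "m = m \<oplus> x \<otimes> \<zero>" using MD(1) x by auto
    then show "m \<in> adjoin M x" unfolding adjoin_def using m sum_squares.zero by blast
  qed
  have "x = \<zero> \<oplus> x \<otimes> \<one>" using x by simp
  then show "x \<in> adjoin M x" unfolding adjoin_def using MD(5) TD(2) by blast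
  have "(y \<otimes> y) \<otimes> s \<in> adjoin M x" if y: "y \<in> carrier R" and s: "s \<in> adjoin M x" for y s
  proof -
    from s obtain m t where mt: "s = m \<oplus> x \<otimes> t" "m \<in> M" "t \<in> sum_squares R"
      unfolding adjoin_def by blast
    have "(y \<otimes> y) \<otimes> s = (y \<otimes> y) \<otimes> m \<oplus> x \<otimes> ((y \<otimes> y) \<otimes> t)"
      using subsetD[OF MD(1) mt(2)] subsetD[OF TD(1) mt(3)] y x unfolding mt(1) by algebra
    then show ?thesis unfolding adjoin_def using mt MD(3) TD(3) y by blast
  qed
  moreover have "s \<oplus> s' \<in> adjoin M x" if s: "s \<in> adjoin M x" and s': "s' \<in> adjoin M x" for s s'
  proof -
    from s obtain m t where mt: "s = m \<oplus> x \<otimes> t" "m \<in> M" "t \<in> sum_squares R"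
      unfolding adjoin_def by blast
    from s' obtain m' t' where mt': "s' = m' \<oplus> x \<otimes> t'" "m' \<in> M" "t' \<in> sum_squares R"
      unfolding adjoin_def by blast
    have "s \<oplus> s' = (m \<oplus> m') \<oplus> x \<otimes> (t \<oplus> t')"
      using subsetD[OF MD(1) mt(2)] subsetD[OF TD(1) mt(3)]
        subsetD[OF MD(1) mt'(2)] subsetD[OF TD(1) mt'(3)] x unfolding mt(1) mt'(1) by algebra
    then show ?thesis unfolding adjoin_def using mt mt' MD(4) TD(4) by blast
  qed
  moreover have "adjoin M x \<subseteq> carrier R"
    using MD(1) TD(1) x unfolding adjoin_def by blast
  ultimately show "quadratic_module R (adjoin M x)"
    unfolding quadratic_module_def using MN MD(2) by blast
qed

end

context field
begin

lemma maximal_quadratic_module_total: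
  assumes M: "quadratic_module R M" and proper: "\<ominus> \<one> \<notin> M"
    and max: "\<And>N. \<lbrakk>quadratic_module R N; \<ominus> \<one> \<notin> N; M \<subseteq> N\<rbrakk> \<Longrightarrow> N = M"
    and x: "x \<in> carrier R"
  shows "x \<in> M \<or> \<ominus> x \<in> M"
proof (rule ccontr)
  assume neg: "\<not> (x \<in> M \<or> \<ominus> x \<in> M)"
  note MD = quadratic_moduleD[OF M]
  have rep: "\<exists>m t. m \<in> M \<and> t \<in> sum_squares R \<and> \<ominus> \<one> = m \<oplus> y \<otimes> t"
    if y: "y \<in> carrier R" "y \<notin> M" for y
  proof -
    have "\<ominus> \<one> \<in> adjoin M y"
      using max[of "adjoin M y"] quadratic_module_adjoin[OF M y(1)] y(2) by blast
    then show ?thesis unfolding adjoin_def by blast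
  qed
  from rep[OF x] neg obtain m t where mt: "m \<in> M" "t \<in> sum_squares R" "\<ominus> \<one> = m \<oplus> x \<otimes> t"
    by blast
  from rep[of "\<ominus> x"] x neg obtain m' t' where
    mt': "m' \<in> M" "t' \<in> sum_squares R" "\<ominus> \<one> = m' \<oplus> (\<ominus> x) \<otimes> t'"
    by auto
  have c: "m \<in> carrier R" "m' \<in> carrier R" "t \<in> carrier R" "t' \<in> carrier R"
    using MD(1) mt mt' sum_squares_closed by auto
  have "t' \<noteq> \<zero>" using mt' proper c x by auto
  then have inv: "inv t' \<in> carrier R" "inv t' \<otimes> t' = \<one>"
    using c field_Units by auto
  have "\<ominus> t' = t \<oplus> (t' \<otimes> m \<oplus> t \<otimes> m')"
  proof -
    have "t \<oplus> (t' \<otimes> m \<oplus> t \<otimes> m') = t \<oplus> (t' \<otimes> (m \<oplus> x \<otimes> t) \<oplus> t \<otimes> (m' \<oplus> (\<ominus> x) \<otimes> t'))"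
      using c x by algebra
    also have "\<dots> = t \<oplus> (t' \<otimes> (\<ominus> \<one>) \<oplus> t \<otimes> (\<ominus> \<one>))"
      unfolding mt(3)[symmetric] mt'(3)[symmetric] ..
    also have "\<dots> = \<ominus> t'" using c by algebra
    finally show ?thesis ..
  qed
  moreover have "t \<in> M"
    using quadratic_module_sum_squares_mult[OF M mt(2) MD(2)] c by simp
  ultimately have "\<ominus> t' \<in> M"
    using MD(4) quadratic_module_sum_squares_mult[OF M] mt mt' by simp
  then have "(inv t' \<otimes> inv t') \<otimes> (t' \<otimes> \<ominus> t') \<in> M"
    using quadratic_module_sum_squares_mult[OF M] mt' MD(3) inv by blast
  moreover have "(inv t' \<otimes> inv t') \<otimes> (t' \<otimes> \<ominus> t') = \<ominus> ((inv t' \<otimes> t') \<otimes> (inv t' \<otimes> t'))"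
    using c inv(1) by algebra
  ultimately show False using inv proper by simp
qed

lemma proper_quadratic_module_inter:
  assumes M: "quadratic_module R M" and proper: "\<ominus> \<one> \<notin> M"
    and two: "\<one> \<oplus> \<one> \<noteq> \<zero>"
    and x: "x \<in> M" "\<ominus> x \<in> M"
  shows "x = \<zero>"
proof (rule ccontr)
  assume nz: "x \<noteq> \<zero>"
  note MD = quadratic_moduleD[OF M]
  have xc: "x \<in> carrier R" using MD(1) x by blast
  then have inv: "inv x \<in> carrier R" "inv x \<otimes> x = \<one>"
    using nz field_Units by auto
  define h where "h = inv (\<one> \<oplus> \<one>)"
  have h: "h \<in> carrier R" "h \<otimes> (\<one> \<oplus> \<one>) = \<one>"
    unfolding h_def using two field_Units by auto
  define u where "u = h \<otimes> (\<one> \<ominus> inv x)"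
  define v where "v = h \<otimes> (\<one> \<oplus> inv x)"
  have uv: "u \<in> carrier R" "v \<in> carrier R" unfolding u_def v_def using h inv by auto
  have "(u \<otimes> u) \<otimes> x \<oplus> (v \<otimes> v) \<otimes> (\<ominus> x)
      = \<ominus> ((h \<otimes> (\<one> \<oplus> \<one>)) \<otimes> (h \<otimes> (\<one> \<oplus> \<one>)) \<otimes> (inv x \<otimes> x))"
    unfolding u_def v_def using h(1) inv(1) xc by algebra
  also have "\<dots> = \<ominus> \<one>" using h inv by simp
  finally show False using MD(3,4) uv x proper by metis
qed

lemma ex_semiordering_containing:
  assumes M: "quadratic_module R M" and proper: "\<ominus> \<one> \<notin> M"
  shows "\<exists>S. semiordering R S \<and> M \<subseteq> S"
proof -
  define \<Q> where "\<Q> = {N. quadratic_module R N \<and> \<ominus> \<one> \<notin> N \<and> M \<subseteq> N}"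
  have "\<exists>S\<in>\<Q>. \<forall>N\<in>\<Q>. S \<subseteq> N \<longrightarrow> N = S"
  proof (rule subset_Zorn_nonempty)
    show "\<Q> \<noteq> {}" unfolding \<Q>_def using assms by blast
    fix C assume C: "C \<noteq> {}" "subset.chain \<Q> C"
    then have sub: "C \<subseteq> \<Q>" by (simp add: subset_chain_def)
    have "s \<oplus> t \<in> (\<Union>C)" if st: "s \<in> (\<Union>C)" "t \<in> (\<Union>C)" for s t
    proof -
      from st obtain N N' where "N \<in> C" "N' \<in> C" "s \<in> N" "t \<in> N'" by blast
      then obtain Z where "Z \<in> C" "s \<in> Z" "t \<in> Z"
        using C(2) unfolding subset_chain_def by blast
      then show ?thesis using sub unfolding \<Q>_def quadratic_module_def by blast
    qed
    moreover have "(\<Union>C) \<subseteq> carrier R"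
      using sub unfolding \<Q>_def quadratic_module_def by blast
    moreover have "\<one> \<in> (\<Union>C)" "\<ominus> \<one> \<notin> (\<Union>C)" "M \<subseteq> (\<Union>C)"
      using sub C(1) unfolding \<Q>_def quadratic_module_def by blast+
    moreover have "(x \<otimes> x) \<otimes> s \<in> (\<Union>C)" if "x \<in> carrier R" "s \<in> (\<Union>C)" for x s
      using that sub unfolding \<Q>_def quadratic_module_def by blast
    ultimately show "(\<Union>C) \<in> \<Q>" unfolding \<Q>_def quadratic_module_def by simp
  qed
  then obtain S where S: "quadratic_module R S" "\<ominus> \<one> \<notin> S" "M \<subseteq> S"
    and max: "\<And>N. \<lbrakk>quadratic_module R N; \<ominus> \<one> \<notin> N; S \<subseteq> N\<rbrakk> \<Longrightarrow> N = S"
    unfolding \<Q>_def by auto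
  note SD = quadratic_moduleD[OF S(1)]
  have two: "\<one> \<oplus> \<one> \<noteq> \<zero>"
    using S(2) SD(2) minus_equality[of \<one> \<one>] by auto
  have tot: "x \<in> S \<union> (\<lambda>s. \<ominus> s) ` S" if "x \<in> carrier R" for x
    using maximal_quadratic_module_total[OF S(1,2) max that] that minus_minus
    by (metis UnCI image_eqI)
  have zero: "x = \<zero>" if "x \<in> S" "x \<in> (\<lambda>s. \<ominus> s) ` S" for x
    using proper_quadratic_module_inter[OF S(1,2) two, of x] that SD(1) by auto
  have "\<zero> \<in> (\<lambda>s. \<ominus> s) ` S" using SD(5) minus_zero by (metis image_eqI)
  then have "S \<inter> (\<lambda>s. \<ominus> s) ` S = {\<zero>}" using zero SD(5) by blast
  moreover have "(\<lambda>s. \<ominus> s) ` S \<subseteq> carrier R" using SD(1) by auto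
  then have "S \<union> (\<lambda>s. \<ominus> s) ` S = carrier R" using tot SD(1) by blast
  ultimately have "semiordering R S"
    unfolding semiordering_def using S(1) unfolding quadratic_module_def by blast
  then show ?thesis using S(3) by blast
qed

end

lemma sum_squares_imp_finsum:
  assumes "cring R" and "s \<in> sum_squares R"
  shows "\<exists>(n::nat) x. x \<in> {..<n} \<rightarrow> carrier R \<and> s = (\<Oplus>\<^bsub>R\<^esub>i\<in>{..<n}. x i \<otimes>\<^bsub>R\<^esub> x i)"
proof -
  interpret cring R by fact
  show ?thesis
    using assms(2)
  proof induction
    case zero
    have "\<zero>\<^bsub>R\<^esub> = (\<Oplus>\<^bsub>R\<^esub>i\<in>{..<0::nat}. \<one>\<^bsub>R\<^esub> \<otimes>\<^bsub>R\<^esub> \<one>\<^bsub>R\<^esub>)" by simp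
    then show ?case by (intro exI[of _ 0] exI[of _ "\<lambda>_. \<one>\<^bsub>R\<^esub>"]) auto
  next
    case (add y s)
    then obtain n :: nat and x where x: "x \<in> {..<n} \<rightarrow> carrier R"
      "s = (\<Oplus>\<^bsub>R\<^esub>i\<in>{..<n}. x i \<otimes>\<^bsub>R\<^esub> x i)" by blast
    have "(\<Oplus>\<^bsub>R\<^esub>i\<in>{..<n}. (x(n := y)) i \<otimes>\<^bsub>R\<^esub> (x(n := y)) i) = s"
      unfolding x(2) using x(1) by (intro finsum_cong') auto
    then have "(\<Oplus>\<^bsub>R\<^esub>i\<in>{..<Suc n}. (x(n := y)) i \<otimes>\<^bsub>R\<^esub> (x(n := y)) i) = y \<otimes>\<^bsub>R\<^esub> y \<oplus>\<^bsub>R\<^esub> s"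
      unfolding lessThan_Suc using x(1) add.hyps by (subst finsum_insert) (auto simp: Pi_def)
    then show ?case using x(1) add.hyps
      by (intro exI[of _ "Suc n"] exI[of _ "x(n := y)"]) (auto simp: less_Suc_eq)
  qed
qed

lemma formally_realD:
  assumes "formally_real R"
  shows "field R" "\<ominus>\<^bsub>R\<^esub> \<one>\<^bsub>R\<^esub> \<notin> sum_squares R"
proof -
  show R: "field R" using assms unfolding formally_real_def by (rule conjunct1)
  show "\<ominus>\<^bsub>R\<^esub> \<one>\<^bsub>R\<^esub> \<notin> sum_squares R"
    using assms sum_squares_imp_finsum[OF fieldE(1)[OF R], of "\<ominus>\<^bsub>R\<^esub> \<one>\<^bsub>R\<^esub>"]
    unfolding formally_real_def by (rule contrapos_nn[OF conjunct2])
qed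

lemma not_sum_squares_semiordering:
  assumes real: "formally_real R" and c: "c \<in> carrier R" "c \<notin> sum_squares R"
  shows "\<exists>S. semiordering R S \<and> c \<notin> S"
proof -
  interpret field R using formally_realD(1)[OF real] .
  have "\<ominus>\<^bsub>R\<^esub> \<one>\<^bsub>R\<^esub> \<notin> adjoin (sum_squares R) (\<ominus>\<^bsub>R\<^esub> c)"
  proof
    assume "\<ominus>\<^bsub>R\<^esub> \<one>\<^bsub>R\<^esub> \<in> adjoin (sum_squares R) (\<ominus>\<^bsub>R\<^esub> c)"
    then obtain m t where mt: "\<ominus>\<^bsub>R\<^esub> \<one>\<^bsub>R\<^esub> = m \<oplus>\<^bsub>R\<^esub> (\<ominus>\<^bsub>R\<^esub> c) \<otimes>\<^bsub>R\<^esub> t"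
      "m \<in> sum_squares R" "t \<in> sum_squares R"
      unfolding adjoin_def by blast
    have mtc: "m \<in> carrier R" "t \<in> carrier R" using mt sum_squares_closed by auto
    have "t \<noteq> \<zero>\<^bsub>R\<^esub>" using mt mtc c formally_realD(2)[OF real] by auto
    then have inv: "inv\<^bsub>R\<^esub> t \<in> carrier R" "inv\<^bsub>R\<^esub> t \<otimes>\<^bsub>R\<^esub> t = \<one>\<^bsub>R\<^esub>"
      using mtc field_Units by auto
    have "c \<otimes>\<^bsub>R\<^esub> t = \<one>\<^bsub>R\<^esub> \<oplus>\<^bsub>R\<^esub> m"
    proof -
      have "\<one>\<^bsub>R\<^esub> = \<ominus>\<^bsub>R\<^esub> (\<ominus>\<^bsub>R\<^esub> \<one>\<^bsub>R\<^esub>)" by simp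
      also have "\<dots> = \<ominus>\<^bsub>R\<^esub> (m \<oplus>\<^bsub>R\<^esub> (\<ominus>\<^bsub>R\<^esub> c) \<otimes>\<^bsub>R\<^esub> t)" unfolding mt(1) ..
      finally have 1: "\<one>\<^bsub>R\<^esub> = \<ominus>\<^bsub>R\<^esub> (m \<oplus>\<^bsub>R\<^esub> (\<ominus>\<^bsub>R\<^esub> c) \<otimes>\<^bsub>R\<^esub> t)" .
      have "c \<otimes>\<^bsub>R\<^esub> t = \<ominus>\<^bsub>R\<^esub> (m \<oplus>\<^bsub>R\<^esub> (\<ominus>\<^bsub>R\<^esub> c) \<otimes>\<^bsub>R\<^esub> t) \<oplus>\<^bsub>R\<^esub> m"
        using mtc c by algebra
      then show ?thesis using 1 by simp
    qed
    have "c = c \<otimes>\<^bsub>R\<^esub> (inv\<^bsub>R\<^esub> t \<otimes>\<^bsub>R\<^esub> t) \<otimes>\<^bsub>R\<^esub> (inv\<^bsub>R\<^esub> t \<otimes>\<^bsub>R\<^esub> t)" using inv c by simp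
    also have "\<dots> = (inv\<^bsub>R\<^esub> t \<otimes>\<^bsub>R\<^esub> inv\<^bsub>R\<^esub> t) \<otimes>\<^bsub>R\<^esub> (t \<otimes>\<^bsub>R\<^esub> (c \<otimes>\<^bsub>R\<^esub> t))"
      using inv(1) mtc c by algebra
    also have "\<dots> = (inv\<^bsub>R\<^esub> t \<otimes>\<^bsub>R\<^esub> inv\<^bsub>R\<^esub> t) \<otimes>\<^bsub>R\<^esub> (t \<otimes>\<^bsub>R\<^esub> (\<one>\<^bsub>R\<^esub> \<oplus>\<^bsub>R\<^esub> m))"
      unfolding \<open>c \<otimes>\<^bsub>R\<^esub> t = _\<close> ..
    also have "\<dots> \<in> sum_squares R"
      by (intro sum_squares_mult square_in_sum_squares inv(1) mt(2,3) sum_squares_add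
          quadratic_moduleD(2)[OF quadratic_module_sum_squares])
    finally show False using c by blast
  qed
  then obtain S where S: "semiordering R S" "adjoin (sum_squares R) (\<ominus>\<^bsub>R\<^esub> c) \<subseteq> S"
    using ex_semiordering_containing quadratic_module_adjoin(1)[OF quadratic_module_sum_squares] c
    by (metis a_inv_closed)
  have "\<ominus>\<^bsub>R\<^esub> c \<in> S"
    using S(2) quadratic_module_adjoin(3)[OF quadratic_module_sum_squares] c by blast
  moreover have "c \<noteq> \<zero>\<^bsub>R\<^esub>" using c sum_squares.zero by blast
  ultimately have "c \<notin> S"
    using S(1) c(1) unfolding semiordering_def by (metis IntI image_eqI minus_minus singletonD)
  then show ?thesis using S(1) by blast
qed

section \<open>Sums of hermitian squares\<close>

locale algebra_with_involution = assoc_algebra R A for R (structure) and A (structure) +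
  fixes \<sigma>
  assumes involution: "involution R A \<sigma>"
begin

lemma sigma_closed [simp]: "x \<in> carrier A \<Longrightarrow> \<sigma> x \<in> carrier A"
  and sigma_add: "\<lbrakk>x \<in> carrier A; y \<in> carrier A\<rbrakk> \<Longrightarrow> \<sigma> (x \<oplus>\<^bsub>A\<^esub> y) = \<sigma> x \<oplus>\<^bsub>A\<^esub> \<sigma> y"
  and sigma_smult: "\<lbrakk>r \<in> carrier R; x \<in> carrier A\<rbrakk> \<Longrightarrow> \<sigma> (r \<odot>\<^bsub>A\<^esub> x) = r \<odot>\<^bsub>A\<^esub> \<sigma> x"
  using involution unfolding involution_def module_hom_def by auto

inductive_set hermitian_sums where
  single: "x \<in> carrier A - {\<zero>\<^bsub>A\<^esub>} \<Longrightarrow> \<sigma> x \<otimes>\<^bsub>A\<^esub> x \<in> hermitian_sums"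
| add: "\<lbrakk>x \<in> carrier A - {\<zero>\<^bsub>A\<^esub>}; s \<in> hermitian_sums\<rbrakk>
    \<Longrightarrow> \<sigma> x \<otimes>\<^bsub>A\<^esub> x \<oplus>\<^bsub>A\<^esub> s \<in> hermitian_sums"

lemma hermitian_sums_closed: "s \<in> hermitian_sums \<Longrightarrow> s \<in> carrier A"
  by (induction rule: hermitian_sums.induct) auto

lemma hermitian_sums_add:
  assumes "s \<in> hermitian_sums" "t \<in> hermitian_sums"
  shows "s \<oplus>\<^bsub>A\<^esub> t \<in> hermitian_sums"
  using assms(1)
proof induction
  case (single x)
  then show ?case using hermitian_sums.add assms(2) by blast
next
  case (add x s)
  then have "\<sigma> x \<otimes>\<^bsub>A\<^esub> x \<oplus>\<^bsub>A\<^esub> s \<oplus>\<^bsub>A\<^esub> t = \<sigma> x \<otimes>\<^bsub>A\<^esub> x \<oplus>\<^bsub>A\<^esub> (s \<oplus>\<^bsub>A\<^esub> t)"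
    using assms(2) hermitian_sums_closed by (simp add: M.a_assoc)
  then show ?case using add hermitian_sums.add by simp
qed

lemma hermitian_sums_imp_finsum:
  assumes "s \<in> hermitian_sums"
  shows "\<exists>(n::nat) x. n \<ge> 1 \<and> x \<in> {..<n} \<rightarrow> carrier A - {\<zero>\<^bsub>A\<^esub>} \<and>
      (\<Oplus>\<^bsub>A\<^esub>i\<in>{..<n}. \<sigma> (x i) \<otimes>\<^bsub>A\<^esub> x i) = s"
  using assms
proof induction
  case (single x)
  have "(\<Oplus>\<^bsub>A\<^esub>i\<in>{..<Suc 0}. \<sigma> x \<otimes>\<^bsub>A\<^esub> x) = \<sigma> x \<otimes>\<^bsub>A\<^esub> x"
    unfolding lessThan_Suc using single by (subst M.finsum_insert) auto
  then show ?case using single by (intro exI[of _ "Suc 0"] exI[of _ "\<lambda>_. x"]) auto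
next
  case (add y s)
  then obtain n :: nat and x where x: "n \<ge> 1" "x \<in> {..<n} \<rightarrow> carrier A - {\<zero>\<^bsub>A\<^esub>}"
    "(\<Oplus>\<^bsub>A\<^esub>i\<in>{..<n}. \<sigma> (x i) \<otimes>\<^bsub>A\<^esub> x i) = s" by blast
  have "(\<Oplus>\<^bsub>A\<^esub>i\<in>{..<n}. \<sigma> ((x(n := y)) i) \<otimes>\<^bsub>A\<^esub> (x(n := y)) i)
      = (\<Oplus>\<^bsub>A\<^esub>i\<in>{..<n}. \<sigma> (x i) \<otimes>\<^bsub>A\<^esub> x i)"
    using x(2) by (intro M.finsum_cong') (auto simp: Pi_def)
  then have "(\<Oplus>\<^bsub>A\<^esub>i\<in>{..<Suc n}. \<sigma> ((x(n := y)) i) \<otimes>\<^bsub>A\<^esub> (x(n := y)) i)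
      = \<sigma> y \<otimes>\<^bsub>A\<^esub> y \<oplus>\<^bsub>A\<^esub> s"
    unfolding lessThan_Suc x(3) using x(2) add.hyps by (subst M.finsum_insert) (auto simp: Pi_def)
  then show ?case using x(2) add.hyps
    by (intro exI[of _ "Suc n"] exI[of _ "x(n := y)"]) (auto simp: less_Suc_eq Pi_iff)
qed

lemma hermitian_sums_weakly_isotropic: "\<zero>\<^bsub>A\<^esub> \<in> hermitian_sums \<Longrightarrow> weakly_isotropic A \<sigma>"
  using hermitian_sums_imp_finsum[of "\<zero>\<^bsub>A\<^esub>"] unfolding weakly_isotropic_def by simp

definition hermitian_cone where
  "hermitian_cone = insert \<zero>\<^bsub>A\<^esub> hermitian_sums"

lemma hermitian_cone_closed: "s \<in> hermitian_cone \<Longrightarrow> s \<in> carrier A"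
  unfolding hermitian_cone_def using hermitian_sums_closed by auto

lemma hermitian_cone_zero: "\<zero>\<^bsub>A\<^esub> \<in> hermitian_cone"
  unfolding hermitian_cone_def by simp

lemma hermitian_cone_square: "x \<in> carrier A \<Longrightarrow> \<sigma> x \<otimes>\<^bsub>A\<^esub> x \<in> hermitian_cone"
  unfolding hermitian_cone_def
  using hermitian_sums.single[of x] by (cases "x = \<zero>\<^bsub>A\<^esub>") auto

lemma hermitian_cone_add:
  "\<lbrakk>s \<in> hermitian_cone; t \<in> hermitian_cone\<rbrakk> \<Longrightarrow> s \<oplus>\<^bsub>A\<^esub> t \<in> hermitian_cone"
  unfolding hermitian_cone_def using hermitian_sums_add hermitian_sums_closed by auto

lemma hermitian_cone_add_eq_zero:
  assumes "\<not> weakly_isotropic A \<sigma>" "s \<in> hermitian_cone" "t \<in> hermitian_cone"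
    and "s \<oplus>\<^bsub>A\<^esub> t = \<zero>\<^bsub>A\<^esub>"
  shows "s = \<zero>\<^bsub>A\<^esub>" "t = \<zero>\<^bsub>A\<^esub>"
proof -
  have "s = \<zero>\<^bsub>A\<^esub> \<or> t = \<zero>\<^bsub>A\<^esub>"
    using assms hermitian_sums_add hermitian_sums_weakly_isotropic
    unfolding hermitian_cone_def by force
  then show "s = \<zero>\<^bsub>A\<^esub>" "t = \<zero>\<^bsub>A\<^esub>"
    using assms(2-4) hermitian_cone_closed by auto
qed

lemma hermitian_square_eq_zero:
  assumes "\<not> weakly_isotropic A \<sigma>" "x \<in> carrier A" "\<sigma> x \<otimes>\<^bsub>A\<^esub> x = \<zero>\<^bsub>A\<^esub>"
  shows "x = \<zero>\<^bsub>A\<^esub>"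
  using assms hermitian_sums.single[of x] hermitian_sums_weakly_isotropic by force

lemma hermitian_cone_smult:
  assumes c: "c \<in> sum_squares R" and x: "x \<in> carrier A"
  shows "c \<odot>\<^bsub>A\<^esub> (\<sigma> x \<otimes>\<^bsub>A\<^esub> x) \<in> hermitian_cone"
  using c
proof induction
  case zero
  show ?case using x hermitian_cone_zero by simp
next
  case (add r s)
  have sc: "s \<in> carrier R" using add R.sum_squares_closed by simp
  have "(r \<otimes> r \<oplus> s) \<odot>\<^bsub>A\<^esub> (\<sigma> x \<otimes>\<^bsub>A\<^esub> x)
      = (r \<otimes> r) \<odot>\<^bsub>A\<^esub> (\<sigma> x \<otimes>\<^bsub>A\<^esub> x) \<oplus>\<^bsub>A\<^esub> s \<odot>\<^bsub>A\<^esub> (\<sigma> x \<otimes>\<^bsub>A\<^esub> x)"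
    using x add sc by (simp add: smult_l_distr)
  also have "(r \<otimes> r) \<odot>\<^bsub>A\<^esub> (\<sigma> x \<otimes>\<^bsub>A\<^esub> x) = \<sigma> (r \<odot>\<^bsub>A\<^esub> x) \<otimes>\<^bsub>A\<^esub> (r \<odot>\<^bsub>A\<^esub> x)"
    using x add by (simp add: sigma_smult smult_mult_left smult_mult_right smult_assoc1)
  finally show ?case
    using hermitian_cone_add[OF hermitian_cone_square add.IH] add.hyps x by simp
qed

lemma hermitian_cone_finsum:
  assumes "finite I" "f \<in> I \<rightarrow> hermitian_cone"
  shows "(\<Oplus>\<^bsub>A\<^esub>i\<in>I. f i) \<in> hermitian_cone"
  using assms
proof (induction I)
  case empty
  show ?case using hermitian_cone_zero by simp
next
  case (insert i I)
  then have "(\<Oplus>\<^bsub>A\<^esub>i\<in>insert i I. f i) = f i \<oplus>\<^bsub>A\<^esub> (\<Oplus>\<^bsub>A\<^esub>i\<in>I. f i)"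
    using hermitian_cone_closed by (intro M.finsum_insert) (auto simp: Pi_def)
  then show ?case using insert hermitian_cone_add by simp
qed

lemma hermitian_cone_finsum_eq_zero:
  assumes "\<not> weakly_isotropic A \<sigma>" "finite I" "f \<in> I \<rightarrow> hermitian_cone"
    and "(\<Oplus>\<^bsub>A\<^esub>i\<in>I. f i) = \<zero>\<^bsub>A\<^esub>" "i \<in> I"
  shows "f i = \<zero>\<^bsub>A\<^esub>"
proof -
  have fin: "finite (I - {i})" "f \<in> (I - {i}) \<rightarrow> hermitian_cone" "f i \<in> hermitian_cone"
    using assms by auto
  have "(\<Oplus>\<^bsub>A\<^esub>i\<in>insert i (I - {i}). f i) = f i \<oplus>\<^bsub>A\<^esub> (\<Oplus>\<^bsub>A\<^esub>i\<in>I - {i}. f i)"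
    using fin hermitian_cone_closed by (intro M.finsum_insert) (auto simp: Pi_def)
  then have "f i \<oplus>\<^bsub>A\<^esub> (\<Oplus>\<^bsub>A\<^esub>i\<in>I - {i}. f i) = \<zero>\<^bsub>A\<^esub>"
    using assms(4,5) by (simp add: insert_absorb)
  then show ?thesis
    using hermitian_cone_add_eq_zero(1)[OF assms(1) fin(3) hermitian_cone_finsum[OF fin(1,2)]]
    by blast
qed

end

section \<open>Scalar extension on representatives\<close>

lemma frag_extend_distrib_fun:
  "frag_extend (\<lambda>x. f x + g x) c = frag_extend f c + frag_extend g c"
  unfolding frag_extend_def by (simp add: frag_cmul_distrib2 sum.distrib)

locale trace_descent = algebra_with_involution R A \<sigma> + L?: field L
    for R (structure) and A (structure) and \<sigma> and L (structure) +
  fixes \<iota> tr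
  assumes field_R: "field R"
    and iota: "\<iota> \<in> ring_hom R L"
    and tr_closed [simp]: "l \<in> carrier L \<Longrightarrow> tr l \<in> carrier R"
    and tr_add: "\<lbrakk>l \<in> carrier L; k \<in> carrier L\<rbrakk> \<Longrightarrow> tr (l \<oplus>\<^bsub>L\<^esub> k) = tr l \<oplus> tr k"
    and tr_scale: "\<lbrakk>r \<in> carrier R; l \<in> carrier L\<rbrakk> \<Longrightarrow> tr (\<iota> r \<otimes>\<^bsub>L\<^esub> l) = r \<otimes> tr l"
    and tr_square: "l \<in> carrier L - {\<zero>\<^bsub>L\<^esub>} \<Longrightarrow> tr (l \<otimes>\<^bsub>L\<^esub> l) \<in> sum_squares R - {\<zero>}"
begin

abbreviation "FG \<equiv> carrier (free_Abelian_group (carrier A \<times> carrier L))"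
abbreviation "ker \<equiv> tensor_kernel R A L \<iota>"
abbreviation "mul \<equiv> monoid.mult (free_tensor_ring A L)"
abbreviation "sg \<equiv> frag_extend (\<lambda>(a, l). frag_of (\<sigma> a, l))"
abbreviation "coset \<equiv> a_r_coset (free_tensor_ring A L) ker"

lemma iota_closed [simp]: "r \<in> carrier R \<Longrightarrow> \<iota> r \<in> carrier L"
  using iota ring_hom_closed by metis

lemma FG_add: "\<lbrakk>c \<in> FG; d \<in> FG\<rbrakk> \<Longrightarrow> c + d \<in> FG"
  and FG_diff: "\<lbrakk>c \<in> FG; d \<in> FG\<rbrakk> \<Longrightarrow> c - d \<in> FG"
  and FG_zero: "0 \<in> FG"
  and FG_of: "\<lbrakk>a \<in> carrier A; l \<in> carrier L\<rbrakk> \<Longrightarrow> frag_of (a, l) \<in> FG"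
  using keys_add[of c d] keys_diff[of c d] by auto

lemma FG_sum: "(\<And>i. i \<in> I \<Longrightarrow> f i \<in> FG) \<Longrightarrow> sum f I \<in> FG"
  by (rule sum_closed_free_Abelian_group)

lemma FG_induct [consumes 1, case_names zero of diff]:
  assumes "c \<in> FG" "P 0"
    and "\<And>a l. \<lbrakk>a \<in> carrier A; l \<in> carrier L\<rbrakk> \<Longrightarrow> P (frag_of (a, l))"
    and "\<And>c d. \<lbrakk>P c; P d\<rbrakk> \<Longrightarrow> P (c - d)"
  shows "P c"
  using assms(1) unfolding carrier_free_Abelian_group_iff
  by (induction rule: frag_induction) (use assms in auto)

lemma relations_FG: "tensor_relations R A L \<iota> \<subseteq> FG"
  unfolding tensor_relations_def by (auto simp del: carrier_free_Abelian_group_iff intro!: FG_diff FG_of)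

lemma subgroup_ker: "subgroup ker (free_Abelian_group (carrier A \<times> carrier L))"
  unfolding tensor_kernel_def
  by (rule group.generate_is_subgroup[OF group_free_Abelian_group relations_FG])

lemma ker_FG: "c \<in> ker \<Longrightarrow> c \<in> FG"
  using subgroup.subset[OF subgroup_ker] by blast

lemma ker_zero: "0 \<in> ker"
  using subgroup.one_closed[OF subgroup_ker] by simp

lemma ker_add: "\<lbrakk>c \<in> ker; d \<in> ker\<rbrakk> \<Longrightarrow> c + d \<in> ker"
  using subgroup.m_closed[OF subgroup_ker] by simp

lemma ker_minus: "c \<in> ker \<Longrightarrow> - c \<in> ker"
  using subgroup.m_inv_closed[OF subgroup_ker, of c] ker_FG[of c] by simp

lemma ker_diff: "\<lbrakk>c \<in> ker; d \<in> ker\<rbrakk> \<Longrightarrow> c - d \<in> ker"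
  using ker_add[OF _ ker_minus, of c d] by simp

lemma ker_sum: "(\<And>i. i \<in> I \<Longrightarrow> f i \<in> ker) \<Longrightarrow> sum f I \<in> ker"
  by (induction I rule: infinite_finite_induct) (auto simp: ker_zero ker_add)

lemma ker_induct [consumes 1, case_names zero rel diff]:
  assumes "c \<in> ker" "P 0" "\<And>c. c \<in> tensor_relations R A L \<iota> \<Longrightarrow> P c"
    and diff: "\<And>c d. \<lbrakk>P c; P d\<rbrakk> \<Longrightarrow> P (c - d)"
  shows "P c"
  using assms(1) unfolding tensor_kernel_def
proof (induction rule: generate.induct)
  case (inv c)
  then show ?case
    using relations_FG diff[OF assms(2), of c] assms(3) by (auto simp: subset_iff)
next
  case (eng c d)
  then show ?case using diff[OF _ diff[OF assms(2)], of c d] by simp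
qed (use assms in auto)

lemma ker_left_add:
  assumes "a \<in> carrier A" "b \<in> carrier A" "l \<in> carrier L"
  shows "frag_of (a \<oplus>\<^bsub>A\<^esub> b, l) - frag_of (a, l) - frag_of (b, l) \<in> ker"
  unfolding tensor_kernel_def
  by (rule generate.incl) (use assms in \<open>unfold tensor_relations_def, blast\<close>)

lemma ker_right_add:
  assumes "a \<in> carrier A" "l \<in> carrier L" "k \<in> carrier L"
  shows "frag_of (a, l \<oplus>\<^bsub>L\<^esub> k) - frag_of (a, l) - frag_of (a, k) \<in> ker"
  unfolding tensor_kernel_def
  by (rule generate.incl) (use assms in \<open>unfold tensor_relations_def, blast\<close>)

lemma ker_smult:
  assumes "r \<in> carrier R" "a \<in> carrier A" "l \<in> carrier L"
  shows "frag_of (r \<odot>\<^bsub>A\<^esub> a, l) - frag_of (a, \<iota> r \<otimes>\<^bsub>L\<^esub> l) \<in> ker"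
  unfolding tensor_kernel_def
  by (rule generate.incl) (use assms in \<open>unfold tensor_relations_def, blast\<close>)

lemma relations_cases [consumes 1]:
  assumes "c \<in> tensor_relations R A L \<iota>"
  obtains (left) a b l where "a \<in> carrier A" "b \<in> carrier A" "l \<in> carrier L"
      "c = frag_of (a \<oplus>\<^bsub>A\<^esub> b, l) - frag_of (a, l) - frag_of (b, l)"
  | (right) a l k where "a \<in> carrier A" "l \<in> carrier L" "k \<in> carrier L"
      "c = frag_of (a, l \<oplus>\<^bsub>L\<^esub> k) - frag_of (a, l) - frag_of (a, k)"
  | (smult) r a l where "r \<in> carrier R" "a \<in> carrier A" "l \<in> carrier L"
      "c = frag_of (r \<odot>\<^bsub>A\<^esub> a, l) - frag_of (a, \<iota> r \<otimes>\<^bsub>L\<^esub> l)"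
  using assms unfolding tensor_relations_def Un_iff mem_Collect_eq
proof (elim disjE exE conjE)
  fix a b l
  assume "c = frag_of (a \<oplus>\<^bsub>A\<^esub> b, l) - frag_of (a, l) - frag_of (b, l)"
    "a \<in> carrier A" "b \<in> carrier A" "l \<in> carrier L"
  then show thesis by (intro left)
next
  fix a l k
  assume "c = frag_of (a, l \<oplus>\<^bsub>L\<^esub> k) - frag_of (a, l) - frag_of (a, k)"
    "a \<in> carrier A" "l \<in> carrier L" "k \<in> carrier L"
  then show thesis by (intro right)
next
  fix r a l
  assume "c = frag_of (r \<odot>\<^bsub>A\<^esub> a, l) - frag_of (a, \<iota> r \<otimes>\<^bsub>L\<^esub> l)"
    "r \<in> carrier R" "a \<in> carrier A" "l \<in> carrier L"
  then show thesis by (intro smult)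
qed

lemma ker_zero_left: "l \<in> carrier L \<Longrightarrow> frag_of (\<zero>\<^bsub>A\<^esub>, l) \<in> ker"
  using ker_minus[OF ker_left_add[of "\<zero>\<^bsub>A\<^esub>" "\<zero>\<^bsub>A\<^esub>" l]] by simp

lemma ker_zero_right: "a \<in> carrier A \<Longrightarrow> frag_of (a, \<zero>\<^bsub>L\<^esub>) \<in> ker"
  using ker_minus[OF ker_right_add[of a "\<zero>\<^bsub>L\<^esub>" "\<zero>\<^bsub>L\<^esub>"]] by simp

lemma mul_of: "mul (frag_of (a, l)) (frag_of (b, k)) = frag_of (a \<otimes>\<^bsub>A\<^esub> b, l \<otimes>\<^bsub>L\<^esub> k)"
  by (simp add: free_tensor_ring_def)

lemma mul_diff_left: "mul (c - c') d = mul c d - mul c' d"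
  by (simp add: free_tensor_ring_def frag_extend_diff)

lemma mul_add_left: "mul (c + c') d = mul c d + mul c' d"
  by (simp add: free_tensor_ring_def frag_extend_add)

lemma mul_add_right: "mul c (d + d') = mul c d + mul c d'"
  by (simp add: free_tensor_ring_def frag_extend_add case_prod_unfold frag_extend_distrib_fun)

lemma mul_diff_right: "mul c (d - d') = mul c d - mul c d'"
  using mul_add_right[of c "d - d'" d'] by simp

lemma mul_zero [simp]: "mul 0 d = 0" "mul c 0 = 0"
  using mul_diff_left[of 0 0 d] mul_diff_right[of c 0 0] by auto

lemma mul_FG: "\<lbrakk>c \<in> FG; d \<in> FG\<rbrakk> \<Longrightarrow> mul c d \<in> FG"
proof (induction c rule: FG_induct)
  case (of a l)
  from of(3) show ?case
  proof (induction d rule: FG_induct)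
    case (of b k)
    then show ?case using \<open>a \<in> carrier A\<close> \<open>l \<in> carrier L\<close> FG_of by (simp add: mul_of)
  qed (auto simp add: mul_diff_right FG_diff FG_zero simp del: carrier_free_Abelian_group_iff)
qed (auto simp add: mul_diff_left FG_diff FG_zero simp del: carrier_free_Abelian_group_iff)

lemma mul_ker_left:
  assumes "c \<in> ker" "d \<in> FG"
  shows "mul c d \<in> ker"
  using assms
proof (induction c rule: ker_induct)
  case (rel c)
  from rel(2) show ?case
  proof (induction d rule: FG_induct)
    case (of b k)
    from rel(1) show ?case
    proof (cases rule: relations_cases)
      case (left a a' l)
      then show ?thesis
        using of ker_left_add[of "a \<otimes>\<^bsub>A\<^esub> b" "a' \<otimes>\<^bsub>A\<^esub> b" "l \<otimes>\<^bsub>L\<^esub> k"]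
        by (simp add: mul_diff_left mul_of A.l_distr)
    next
      case (right a l l')
      then show ?thesis
        using of ker_right_add[of "a \<otimes>\<^bsub>A\<^esub> b" "l \<otimes>\<^bsub>L\<^esub> k" "l' \<otimes>\<^bsub>L\<^esub> k"]
        by (simp add: mul_diff_left mul_of L.l_distr)
    next
      case (smult r a l)
      then show ?thesis
        using of ker_smult[of r "a \<otimes>\<^bsub>A\<^esub> b" "l \<otimes>\<^bsub>L\<^esub> k"]
        by (simp add: mul_diff_left mul_of smult_mult_left L.m_assoc)
    qed
  qed (auto simp: mul_diff_right ker_diff ker_zero)
qed (auto simp: mul_diff_left ker_diff ker_zero)

lemma mul_ker_right:
  assumes "d \<in> ker" "c \<in> FG"
  shows "mul c d \<in> ker"
  using assms
proof (induction d rule: ker_induct)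
  case (rel d)
  from rel(2) show ?case
  proof (induction c rule: FG_induct)
    case (of b k)
    from rel(1) show ?case
    proof (cases rule: relations_cases)
      case (left a a' l)
      then show ?thesis
        using of ker_left_add[of "b \<otimes>\<^bsub>A\<^esub> a" "b \<otimes>\<^bsub>A\<^esub> a'" "k \<otimes>\<^bsub>L\<^esub> l"]
        by (simp add: mul_diff_right mul_of A.r_distr)
    next
      case (right a l l')
      then show ?thesis
        using of ker_right_add[of "b \<otimes>\<^bsub>A\<^esub> a" "k \<otimes>\<^bsub>L\<^esub> l" "k \<otimes>\<^bsub>L\<^esub> l'"]
        by (simp add: mul_diff_right mul_of L.r_distr)
    next
      case (smult r a l)
      then show ?thesis
        using of ker_smult[of r "b \<otimes>\<^bsub>A\<^esub> a" "k \<otimes>\<^bsub>L\<^esub> l"]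
        by (simp add: mul_diff_right mul_of smult_mult_right L.m_lcomm)
    qed
  qed (auto simp: mul_diff_left ker_diff ker_zero)
qed (auto simp: mul_diff_right ker_diff ker_zero)

lemma sg_FG: "c \<in> FG \<Longrightarrow> sg c \<in> FG"
proof (induction c rule: FG_induct)
  case (of a l)
  then show ?case using FG_of by simp
qed (auto simp add: frag_extend_diff FG_diff FG_zero simp del: carrier_free_Abelian_group_iff)

lemma sg_ker: "c \<in> ker \<Longrightarrow> sg c \<in> ker"
proof (induction c rule: ker_induct)
  case (rel c)
  then show ?case
  proof (cases rule: relations_cases)
    case (left a b l)
    then show ?thesis using ker_left_add[of "\<sigma> a" "\<sigma> b" l] by (simp add: frag_extend_diff sigma_add)
  next
    case (right a l k)
    then show ?thesis using ker_right_add[of "\<sigma> a" l k] by (simp add: frag_extend_diff)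
  next
    case (smult r a l)
    then show ?thesis using ker_smult[of r "\<sigma> a" l] by (simp add: frag_extend_diff sigma_smult)
  qed
qed (auto simp: frag_extend_diff ker_diff ker_zero)

lemma mul_cong:
  assumes "c \<in> FG" "c' \<in> FG" "d \<in> FG" "d' \<in> FG" "c - c' \<in> ker" "d - d' \<in> ker"
  shows "mul c d - mul c' d' \<in> ker"
proof -
  have "mul c d - mul c' d' = mul (c - c') d + mul c' (d - d')"
    by (simp add: mul_diff_left mul_diff_right)
  then show ?thesis using assms mul_ker_left mul_ker_right ker_add by simp
qed

lemma mem_coset: "d \<in> coset c \<longleftrightarrow> d - c \<in> ker"
proof -
  have "d \<in> coset c \<longleftrightarrow> (\<exists>h\<in>ker. d = h + c)"
    unfolding a_r_coset_def' by (simp add: free_tensor_ring_def)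
  also have "\<dots> \<longleftrightarrow> d - c \<in> ker" by (metis add_diff_cancel diff_add_cancel)
  finally show ?thesis .
qed

lemma coset_FG: "\<lbrakk>c \<in> FG; d \<in> coset c\<rbrakk> \<Longrightarrow> d \<in> FG"
  unfolding mem_coset using FG_add[OF ker_FG[of "d - c"], of c] by simp

lemma coset_self: "c \<in> coset c"
  unfolding mem_coset using ker_zero by simp

lemma coset_eq: "coset c = coset d \<longleftrightarrow> c - d \<in> ker"
proof
  assume "coset c = coset d"
  then show "c - d \<in> ker" using coset_self[of c] mem_coset by blast
next
  assume cd: "c - d \<in> ker"
  have "x - c \<in> ker \<longleftrightarrow> x - d \<in> ker" for x
    using ker_add[OF _ cd, of "x - c"] ker_diff[OF _ cd, of "x - d"] by auto
  then show "coset c = coset d" using mem_coset by blast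
qed

lemma coset_zero: "coset 0 = ker"
  using mem_coset by auto

lemma carrier_base_change: "carrier (base_change R A L \<iota>) = coset ` FG"
  and zero_base_change: "\<zero>\<^bsub>base_change R A L \<iota>\<^esub> = ker"
  unfolding base_change_def base_change_ring_def FactRing_def ring.defs A_RCOSETS_def'
  by (auto simp: free_tensor_ring_def)

lemma add_base_change: "coset c \<oplus>\<^bsub>base_change R A L \<iota>\<^esub> coset d = coset (c + d)"
proof -
  have "coset c \<oplus>\<^bsub>base_change R A L \<iota>\<^esub> coset d = (\<Union>x\<in>coset c. \<Union>y\<in>coset d. {x + y})"
    unfolding base_change_def base_change_ring_def FactRing_def ring.defs
    by (simp add: set_add_def') (simp add: free_tensor_ring_def)
  also have "\<dots> = coset (c + d)"
  proof (intro equalityI subsetI)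
    fix x assume "x \<in> (\<Union>x\<in>coset c. \<Union>y\<in>coset d. {x + y})"
    then obtain y z where "x = y + z" "y - c \<in> ker" "z - d \<in> ker" by (auto simp: mem_coset)
    then show "x \<in> coset (c + d)"
      using ker_add[of "y - c" "z - d"] by (simp add: mem_coset algebra_simps)
  next
    fix x assume x: "x \<in> coset (c + d)"
    then have "x - d \<in> coset c" by (simp add: mem_coset algebra_simps)
    moreover have "x = (x - d) + d" by simp
    ultimately show "x \<in> (\<Union>x\<in>coset c. \<Union>y\<in>coset d. {x + y})" using coset_self by blast
  qed
  finally show ?thesis .
qed

lemma mult_base_change:
  assumes "c \<in> FG" "d \<in> FG"
  shows "coset c \<otimes>\<^bsub>base_change R A L \<iota>\<^esub> coset d = coset (mul c d)"
proof -
  have "coset c \<otimes>\<^bsub>base_change R A L \<iota>\<^esub> coset d = (\<Union>x\<in>coset c. \<Union>y\<in>coset d. coset (mul x y))"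
    unfolding base_change_def base_change_ring_def FactRing_def ring.defs
    by (simp add: rcoset_mult_def)
  also have "\<dots> = (\<Union>x\<in>coset c. \<Union>y\<in>coset d. coset (mul c d))"
  proof (intro SUP_cong refl)
    fix x y assume xy: "x \<in> coset c" "y \<in> coset d"
    then show "coset (mul x y) = coset (mul c d)"
      using mul_cong[of x c y d] assms coset_FG unfolding coset_eq mem_coset by blast
  qed
  also have "\<dots> = coset (mul c d)" using coset_self by blast
  finally show ?thesis .
qed

lemma base_change_map_coset: "base_change_map R A L \<iota> \<sigma> (coset c) = coset (sg c)"
proof -
  have "base_change_map R A L \<iota> \<sigma> (coset c) = (\<Union>x\<in>coset c. coset (sg c))"
    unfolding base_change_map_def
  proof (intro SUP_cong refl)
    fix x assume "x \<in> coset c"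
    then show "coset (sg x) = coset (sg c)"
      using sg_ker[of "x - c"] unfolding coset_eq mem_coset by (simp add: frag_extend_diff)
  qed
  also have "\<dots> = coset (sg c)" using coset_self by blast
  finally show ?thesis .
qed

lemma abelian_monoid_base_change: "abelian_monoid (base_change R A L \<iota>)"
proof (rule abelian_monoidI, unfold carrier_base_change zero_base_change)
  show "ker \<in> coset ` FG" using imageI[OF FG_zero, of coset] unfolding coset_zero .
next
  fix x y assume "x \<in> coset ` FG" "y \<in> coset ` FG"
  then obtain c d where cd: "x = coset c" "y = coset d" "c \<in> FG" "d \<in> FG" by blast
  show "x \<oplus>\<^bsub>base_change R A L \<iota>\<^esub> y \<in> coset ` FG"
    unfolding cd add_base_change by (intro imageI FG_add cd)
  show "x \<oplus>\<^bsub>base_change R A L \<iota>\<^esub> y = y \<oplus>\<^bsub>base_change R A L \<iota>\<^esub> x"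
    unfolding cd add_base_change add.commute[of c] ..
  show "ker \<oplus>\<^bsub>base_change R A L \<iota>\<^esub> x = x"
    using add_base_change[of 0 c] unfolding cd coset_zero add_0 .
  fix z assume "z \<in> coset ` FG"
  then obtain e where e: "z = coset e" by blast
  show "x \<oplus>\<^bsub>base_change R A L \<iota>\<^esub> y \<oplus>\<^bsub>base_change R A L \<iota>\<^esub> z
      = x \<oplus>\<^bsub>base_change R A L \<iota>\<^esub> (y \<oplus>\<^bsub>base_change R A L \<iota>\<^esub> z)"
    unfolding cd e add_base_change add.assoc ..
qed

lemma finsum_base_change:
  assumes "finite I" "\<And>i. i \<in> I \<Longrightarrow> f i \<in> FG"
  shows "(\<Oplus>\<^bsub>base_change R A L \<iota>\<^esub>i\<in>I. coset (f i)) = coset (\<Sum>i\<in>I. f i)"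
proof -
  interpret B: abelian_monoid "base_change R A L \<iota>" by (rule abelian_monoid_base_change)
  show ?thesis
    using assms
  proof (induction I)
    case empty
    show ?case using coset_zero by (simp add: zero_base_change)
  next
    case (insert i I)
    then have "(\<Oplus>\<^bsub>base_change R A L \<iota>\<^esub>i\<in>insert i I. coset (f i))
        = coset (f i) \<oplus>\<^bsub>base_change R A L \<iota>\<^esub> (\<Oplus>\<^bsub>base_change R A L \<iota>\<^esub>i\<in>I. coset (f i))"
      by (intro B.finsum_insert) (auto simp only: carrier_base_change intro!: imageI insertI1 insertI2)
    then show ?case using insert by (simp add: add_base_change)
  qed
qed

end

section \<open>Descent along a trace form\<close>

context trace_descent
begin

text \<open>This is \<open>id \<otimes> tr : A \<otimes> L \<rightarrow> A\<close>, on representatives.\<close>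

definition trA where
  "trA = (SOME h. h \<in> hom (free_Abelian_group (carrier A \<times> carrier L)) (add_monoid A) \<and>
     (\<forall>x\<in>carrier A \<times> carrier L. h (frag_of x) = tr (snd x) \<odot>\<^bsub>A\<^esub> fst x))"

lemma trA: "trA \<in> hom (free_Abelian_group (carrier A \<times> carrier L)) (add_monoid A)"
  "\<lbrakk>a \<in> carrier A; l \<in> carrier L\<rbrakk> \<Longrightarrow> trA (frag_of (a, l)) = tr l \<odot>\<^bsub>A\<^esub> a"
proof -
  have "comm_group (add_monoid A)" by (rule M.a_comm_group)
  moreover have "(\<lambda>x. tr (snd x) \<odot>\<^bsub>A\<^esub> fst x) ` (carrier A \<times> carrier L) \<subseteq> carrier (add_monoid A)"
    by auto
  ultimately obtain h where "h \<in> hom (free_Abelian_group (carrier A \<times> carrier L)) (add_monoid A)"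
    "\<And>x. x \<in> carrier A \<times> carrier L \<Longrightarrow> h (frag_of x) = tr (snd x) \<odot>\<^bsub>A\<^esub> fst x"
    by (rule comm_group.free_Abelian_group_universal) blast
  then have "\<exists>h. h \<in> hom (free_Abelian_group (carrier A \<times> carrier L)) (add_monoid A) \<and>
     (\<forall>x\<in>carrier A \<times> carrier L. h (frag_of x) = tr (snd x) \<odot>\<^bsub>A\<^esub> fst x)" by blast
  from someI_ex[OF this, folded trA_def]
  show "trA \<in> hom (free_Abelian_group (carrier A \<times> carrier L)) (add_monoid A)"
    "\<lbrakk>a \<in> carrier A; l \<in> carrier L\<rbrakk> \<Longrightarrow> trA (frag_of (a, l)) = tr l \<odot>\<^bsub>A\<^esub> a" by auto
qed

lemma trA_closed [simp]: "c \<in> FG \<Longrightarrow> trA c \<in> carrier A"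
  using hom_in_carrier[OF trA(1)] by simp

lemma trA_add: "\<lbrakk>c \<in> FG; d \<in> FG\<rbrakk> \<Longrightarrow> trA (c + d) = trA c \<oplus>\<^bsub>A\<^esub> trA d"
  using hom_mult[OF trA(1)] by simp

lemma trA_zero: "trA 0 = \<zero>\<^bsub>A\<^esub>"
  using trA_add[OF FG_zero FG_zero] trA_closed[OF FG_zero] by simp

lemma trA_diff: "\<lbrakk>c \<in> FG; d \<in> FG\<rbrakk> \<Longrightarrow> trA (c - d) = trA c \<ominus>\<^bsub>A\<^esub> trA d"
  using trA_add[OF FG_diff, of c d d] trA_closed[of c] trA_closed[of d] trA_closed[OF FG_diff, of c d]
  by (simp add: M.minus_eq M.a_assoc M.r_neg)

lemma trA_sum:
  assumes "finite I" "\<And>i. i \<in> I \<Longrightarrow> f i \<in> FG"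
  shows "trA (\<Sum>i\<in>I. f i) = (\<Oplus>\<^bsub>A\<^esub>i\<in>I. trA (f i))"
  using assms
proof (induction I)
  case (insert i I)
  then have "(\<Oplus>\<^bsub>A\<^esub>i\<in>insert i I. trA (f i)) = trA (f i) \<oplus>\<^bsub>A\<^esub> (\<Oplus>\<^bsub>A\<^esub>i\<in>I. trA (f i))"
    by (intro M.finsum_insert) (auto simp del: carrier_free_Abelian_group_iff)
  then show ?case using insert trA_add[of "f i" "sum f I"] FG_sum[of I f] by simp
qed (simp add: trA_zero)

lemma add_minus_cancel:
  assumes "u \<in> carrier A" "v \<in> carrier A"
  shows "u \<oplus>\<^bsub>A\<^esub> v \<ominus>\<^bsub>A\<^esub> u \<ominus>\<^bsub>A\<^esub> v = \<zero>\<^bsub>A\<^esub>"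
proof -
  have "u \<oplus>\<^bsub>A\<^esub> v \<ominus>\<^bsub>A\<^esub> u \<ominus>\<^bsub>A\<^esub> v = (u \<oplus>\<^bsub>A\<^esub> v) \<oplus>\<^bsub>A\<^esub> \<ominus>\<^bsub>A\<^esub> (u \<oplus>\<^bsub>A\<^esub> v)"
    using assms by (simp add: M.minus_eq M.minus_add M.a_assoc)
  then show ?thesis using assms by (simp add: M.r_neg)
qed

lemma trA_ker: "c \<in> ker \<Longrightarrow> trA c = \<zero>\<^bsub>A\<^esub>"
proof -
  assume "c \<in> ker"
  then have "c \<in> FG \<and> trA c = \<zero>\<^bsub>A\<^esub>"
  proof (induction c rule: ker_induct)
    case zero
    show ?case using FG_zero trA_zero by simp
  next
    case (rel c)
    then have "c \<in> FG" using relations_FG by blast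
    moreover from rel have "trA c = \<zero>\<^bsub>A\<^esub>"
    proof (cases rule: relations_cases)
      case (left a b l)
      then show ?thesis
        by (simp add: trA_diff FG_diff FG_of trA(2) smult_r_distr add_minus_cancel
            del: carrier_free_Abelian_group_iff)
    next
      case (right a l k)
      then show ?thesis
        by (simp add: trA_diff FG_diff FG_of trA(2) smult_l_distr tr_add add_minus_cancel
            del: carrier_free_Abelian_group_iff)
    next
      case (smult r a l)
      then show ?thesis
        by (simp add: trA_diff FG_of trA(2) smult_assoc1[symmetric] tr_scale R.m_comm M.minus_eq M.r_neg
            del: carrier_free_Abelian_group_iff)
    qed
    ultimately show ?case ..
  next
    case (diff c d)
    then show ?case
      using FG_diff[of c d] by (simp add: trA_diff M.minus_eq del: carrier_free_Abelian_group_iff)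
  qed
  then show ?thesis ..
qed

lemma trA_cong: "\<lbrakk>c \<in> FG; d \<in> FG; c - d \<in> ker\<rbrakk> \<Longrightarrow> trA c = trA d"
  using trA_add[OF FG_diff, of c d d] trA_ker[of "c - d"] trA_closed[of d] by simp

abbreviation "trA_square c \<equiv> trA (mul (sg c) c)"

lemma trA_square_cong: "\<lbrakk>c \<in> FG; d \<in> FG; c - d \<in> ker\<rbrakk> \<Longrightarrow> trA_square c = trA_square d"
  using sg_ker[of "c - d"] by (intro trA_cong mul_cong mul_FG sg_FG) (auto simp: frag_extend_diff)

definition orthogonal where
  "orthogonal E \<longleftrightarrow> finite E \<and> E \<subseteq> carrier L - {\<zero>\<^bsub>L\<^esub>} \<and>
     (\<forall>e\<in>E. \<forall>e'\<in>E. e \<noteq> e' \<longrightarrow> tr (e \<otimes>\<^bsub>L\<^esub> e') = \<zero>)"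

lemma combination_FG:
  "\<lbrakk>E \<subseteq> carrier L; b \<in> E \<rightarrow> carrier A\<rbrakk> \<Longrightarrow> (\<Sum>e\<in>E. frag_of (b e, e)) \<in> FG"
  by (intro FG_sum FG_of) auto

lemma trA_mult_orthogonal:
  assumes "finite E" "E \<subseteq> carrier L" "b \<in> E \<rightarrow> carrier A" "a \<in> carrier A" "l \<in> carrier L"
    and "\<And>e. e \<in> E \<Longrightarrow> tr (l \<otimes>\<^bsub>L\<^esub> e) = \<zero>"
  shows "trA (mul (frag_of (a, l)) (\<Sum>e\<in>E. frag_of (b e, e))) = \<zero>\<^bsub>A\<^esub>"
    "trA (mul (\<Sum>e\<in>E. frag_of (b e, e)) (frag_of (a, l))) = \<zero>\<^bsub>A\<^esub>"
proof -
  have "trA (mul (frag_of (a, l)) (\<Sum>e\<in>E. frag_of (b e, e))) = \<zero>\<^bsub>A\<^esub> \<and>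
    trA (mul (\<Sum>e\<in>E. frag_of (b e, e)) (frag_of (a, l))) = \<zero>\<^bsub>A\<^esub>"
    using assms
  proof (induction E)
    case empty
    show ?case by (simp add: trA_zero)
  next
    case (insert e E)
    have FG: "mul (frag_of (a, l)) (\<Sum>e\<in>E. frag_of (b e, e)) \<in> FG"
      "mul (\<Sum>e\<in>E. frag_of (b e, e)) (frag_of (a, l)) \<in> FG"
      using insert.prems by (intro mul_FG combination_FG FG_of; simp)+
    have of: "trA (mul (frag_of (a, l)) (frag_of (b e, e))) = \<zero>\<^bsub>A\<^esub>"
      "trA (mul (frag_of (b e, e)) (frag_of (a, l))) = \<zero>\<^bsub>A\<^esub>"
      "mul (frag_of (a, l)) (frag_of (b e, e)) \<in> FG" "mul (frag_of (b e, e)) (frag_of (a, l)) \<in> FG"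
      using insert.prems L.m_comm[of e l]
      by (auto simp add: mul_of trA(2) intro!: FG_of simp del: carrier_free_Abelian_group_iff)
    show ?case
      using insert FG of
      by (simp add: mul_add_left mul_add_right trA_add del: carrier_free_Abelian_group_iff)
  qed
  then show "trA (mul (frag_of (a, l)) (\<Sum>e\<in>E. frag_of (b e, e))) = \<zero>\<^bsub>A\<^esub>"
    "trA (mul (\<Sum>e\<in>E. frag_of (b e, e)) (frag_of (a, l))) = \<zero>\<^bsub>A\<^esub>" by blast+
qed

lemma orthogonal_combination:
  assumes "orthogonal E" "b \<in> E \<rightarrow> carrier A"
  defines "c \<equiv> \<Sum>e\<in>E. frag_of (b e, e)"
  shows "trA_square c \<in> hermitian_cone"
    and "\<lbrakk>\<not> weakly_isotropic A \<sigma>; trA_square c = \<zero>\<^bsub>A\<^esub>\<rbrakk> \<Longrightarrow> c \<in> ker"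
proof -
  have fin: "finite E" using assms(1) unfolding orthogonal_def by blast
  have "trA_square c \<in> hermitian_cone \<and>
    (\<not> weakly_isotropic A \<sigma> \<longrightarrow> trA_square c = \<zero>\<^bsub>A\<^esub> \<longrightarrow> c \<in> ker)"
    using fin assms(1,2) unfolding c_def
  proof (induction E)
    case empty
    show ?case using hermitian_cone_zero ker_zero by (simp add: trA_zero)
  next
    case (insert e E)
    define d where "d = (\<Sum>e\<in>E. frag_of (b e, e))"
    have E: "orthogonal E" "E \<subseteq> carrier L" "e \<in> carrier L - {\<zero>\<^bsub>L\<^esub>}" "b e \<in> carrier A" "b \<in> E \<rightarrow> carrier A"
      "\<And>e'. e' \<in> E \<Longrightarrow> tr (e \<otimes>\<^bsub>L\<^esub> e') = \<zero>"
      using insert.prems insert.hyps unfolding orthogonal_def by auto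
    have IH: "trA_square d \<in> hermitian_cone" "\<lbrakk>\<not> weakly_isotropic A \<sigma>; trA_square d = \<zero>\<^bsub>A\<^esub>\<rbrakk> \<Longrightarrow> d \<in> ker"
      using insert.IH E unfolding d_def by blast+
    have dFG: "d \<in> FG" "sg d \<in> FG" unfolding d_def using E by (intro combination_FG sg_FG; simp)+
    have sgd: "sg d = (\<Sum>e\<in>E. frag_of (\<sigma> (b e), e))"
      unfolding d_def using insert.hyps by (simp add: frag_extend_sum comp_def)
    let ?x = "frag_of (b e, e)" and ?y = "frag_of (\<sigma> (b e), e)"
    have xFG: "?x \<in> FG" "?y \<in> FG" using E FG_of by auto
    have "mul (sg (?x + d)) (?x + d) = mul ?y ?x + mul ?y d + (mul (sg d) ?x + mul (sg d) d)"
      by (simp add: frag_extend_add mul_add_left mul_add_right)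
    then have "trA_square (?x + d)
        = trA (mul ?y ?x) \<oplus>\<^bsub>A\<^esub> trA (mul ?y d) \<oplus>\<^bsub>A\<^esub> (trA (mul (sg d) ?x) \<oplus>\<^bsub>A\<^esub> trA_square d)"
      using dFG xFG by (simp add: trA_add FG_add mul_FG del: carrier_free_Abelian_group_iff)
    also have "trA (mul ?y d) = \<zero>\<^bsub>A\<^esub>"
      unfolding d_def using E insert.hyps by (intro trA_mult_orthogonal) auto
    also have "trA (mul (sg d) ?x) = \<zero>\<^bsub>A\<^esub>"
      unfolding sgd using E insert.hyps by (intro trA_mult_orthogonal) (auto simp: Pi_def)
    also have sq: "trA (mul ?y ?x) = tr (e \<otimes>\<^bsub>L\<^esub> e) \<odot>\<^bsub>A\<^esub> (\<sigma> (b e) \<otimes>\<^bsub>A\<^esub> b e)"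
      using E by (simp add: mul_of trA(2))
    finally have split: "trA_square (?x + d)
        = tr (e \<otimes>\<^bsub>L\<^esub> e) \<odot>\<^bsub>A\<^esub> (\<sigma> (b e) \<otimes>\<^bsub>A\<^esub> b e) \<oplus>\<^bsub>A\<^esub> trA_square d"
      using E hermitian_cone_closed[OF IH(1)] by simp
    have tre: "tr (e \<otimes>\<^bsub>L\<^esub> e) \<in> sum_squares R" "tr (e \<otimes>\<^bsub>L\<^esub> e) \<noteq> \<zero>" "tr (e \<otimes>\<^bsub>L\<^esub> e) \<in> carrier R"
      using tr_square[OF E(3)] R.sum_squares_closed by auto
    note cone = hermitian_cone_smult[OF tre(1) E(4)]
    have "?x + d \<in> ker" if an: "\<not> weakly_isotropic A \<sigma>" and z: "trA_square (?x + d) = \<zero>\<^bsub>A\<^esub>"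
    proof -
      interpret Rf: field R by (rule field_R)
      note zs = hermitian_cone_add_eq_zero[OF an cone IH(1) z[unfolded split]]
      let ?t = "tr (e \<otimes>\<^bsub>L\<^esub> e)"
      have inv: "inv ?t \<in> carrier R" "inv ?t \<otimes> ?t = \<one>" using tre Rf.field_Units by auto
      have "\<sigma> (b e) \<otimes>\<^bsub>A\<^esub> b e = inv ?t \<odot>\<^bsub>A\<^esub> (?t \<odot>\<^bsub>A\<^esub> (\<sigma> (b e) \<otimes>\<^bsub>A\<^esub> b e))"
        using inv tre E by (simp add: smult_assoc1[symmetric])
      also have "\<dots> = \<zero>\<^bsub>A\<^esub>" unfolding zs(1) using inv by simp
      finally have "b e = \<zero>\<^bsub>A\<^esub>" using hermitian_square_eq_zero[OF an E(4)] by simp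
      then show ?thesis using ker_add ker_zero_left IH(2)[OF an zs(2)] E by simp
    qed
    then show ?case
      using insert.hyps hermitian_cone_add[OF cone IH(1)] split unfolding d_def by simp
  qed
  then show "trA_square c \<in> hermitian_cone"
    "\<lbrakk>\<not> weakly_isotropic A \<sigma>; trA_square c = \<zero>\<^bsub>A\<^esub>\<rbrakk> \<Longrightarrow> c \<in> ker" by blast+
qed

definition spanned where
  "spanned E = {c \<in> FG. \<exists>b\<in>E \<rightarrow> carrier A. c - (\<Sum>e\<in>E. frag_of (b e, e)) \<in> ker}"

lemma spanned_add:
  assumes E: "finite E" "E \<subseteq> carrier L" and "c \<in> spanned E" "d \<in> spanned E"
  shows "c + d \<in> spanned E"
proof -
  from assms obtain b b' where c: "c \<in> FG" "b \<in> E \<rightarrow> carrier A" "c - (\<Sum>e\<in>E. frag_of (b e, e)) \<in> ker"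
    and d: "d \<in> FG" "b' \<in> E \<rightarrow> carrier A" "d - (\<Sum>e\<in>E. frag_of (b' e, e)) \<in> ker"
    unfolding spanned_def by blast
  let ?b = "\<lambda>e. b e \<oplus>\<^bsub>A\<^esub> b' e"
  have "(\<Sum>e\<in>E. frag_of (?b e, e) - frag_of (b e, e) - frag_of (b' e, e)) \<in> ker"
    using E c d by (intro ker_sum ker_left_add) auto
  then have "(\<Sum>e\<in>E. frag_of (?b e, e)) - (\<Sum>e\<in>E. frag_of (b e, e)) - (\<Sum>e\<in>E. frag_of (b' e, e)) \<in> ker"
    by (simp add: sum_subtractf)
  from ker_diff[OF ker_add[OF c(3) d(3)] this]
  have "c + d - (\<Sum>e\<in>E. frag_of (?b e, e)) \<in> ker" by (simp add: algebra_simps)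
  moreover have "?b \<in> E \<rightarrow> carrier A" using c d by auto
  ultimately show ?thesis unfolding spanned_def using FG_add[OF c(1) d(1)]
    by (intro CollectI conjI bexI[of _ ?b])
qed

lemma spanned_minus:
  assumes E: "finite E" "E \<subseteq> carrier L" and "c \<in> spanned E"
  shows "- c \<in> spanned E"
proof -
  from assms obtain b where c: "c \<in> FG" "b \<in> E \<rightarrow> carrier A" "c - (\<Sum>e\<in>E. frag_of (b e, e)) \<in> ker"
    unfolding spanned_def by blast
  let ?b = "\<lambda>e. \<ominus>\<^bsub>A\<^esub> b e"
  have "(\<Sum>e\<in>E. frag_of (?b e \<oplus>\<^bsub>A\<^esub> b e, e) - frag_of (?b e, e) - frag_of (b e, e)) \<in> ker"
    using E c by (intro ker_sum ker_left_add) auto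
  moreover have "(\<Sum>e\<in>E. frag_of (?b e \<oplus>\<^bsub>A\<^esub> b e, e)) \<in> ker"
    using E c ker_zero_left by (intro ker_sum) (auto simp: Pi_def M.l_neg subset_iff)
  ultimately have "(\<Sum>e\<in>E. frag_of (?b e \<oplus>\<^bsub>A\<^esub> b e, e))
      - (\<Sum>e\<in>E. frag_of (?b e \<oplus>\<^bsub>A\<^esub> b e, e) - frag_of (?b e, e) - frag_of (b e, e)) \<in> ker"
    by (rule ker_diff[rotated])
  then have "(\<Sum>e\<in>E. frag_of (?b e, e)) + (\<Sum>e\<in>E. frag_of (b e, e)) \<in> ker"
    by (simp add: sum_subtractf sum.distrib algebra_simps)
  from ker_minus[OF ker_add[OF c(3) this]]
  have "- c - (\<Sum>e\<in>E. frag_of (?b e, e)) \<in> ker" by (simp add: algebra_simps)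
  moreover have "?b \<in> E \<rightarrow> carrier A" using c by auto
  moreover have "- c \<in> FG" using c(1) by simp
  ultimately show ?thesis unfolding spanned_def by (intro CollectI conjI bexI[of _ ?b])
qed

lemma spanned_ker:
  assumes E: "finite E" "E \<subseteq> carrier L" and "c \<in> ker"
  shows "c \<in> spanned E"
proof -
  have "c - (\<Sum>e\<in>E. frag_of (\<zero>\<^bsub>A\<^esub>, e)) \<in> ker"
    using assms by (intro ker_diff ker_sum ker_zero_left) auto
  then show ?thesis
    unfolding spanned_def using ker_FG[OF assms(3)]
    by (intro CollectI conjI bexI[of _ "\<lambda>_. \<zero>\<^bsub>A\<^esub>"]) (simp_all del: carrier_free_Abelian_group_iff)
qed

lemma spanned_cong:
  assumes E: "finite E" "E \<subseteq> carrier L" and "c - d \<in> ker" "d \<in> spanned E"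
  shows "c \<in> spanned E"
  using spanned_add[OF E spanned_ker[OF E assms(3)] assms(4)] by simp

lemma spanned_mono:
  assumes E: "finite E'" "E' \<subseteq> carrier L" and sub: "E \<subseteq> E'" and c: "c \<in> spanned E"
  shows "c \<in> spanned E'"
proof -
  from c obtain b where b: "c \<in> FG" "b \<in> E \<rightarrow> carrier A" "c - (\<Sum>e\<in>E. frag_of (b e, e)) \<in> ker"
    unfolding spanned_def by blast
  let ?b = "\<lambda>e. if e \<in> E then b e else \<zero>\<^bsub>A\<^esub>"
  have "(\<Sum>e\<in>E'. frag_of (?b e, e)) = (\<Sum>e\<in>E' - E. frag_of (?b e, e)) + (\<Sum>e\<in>E. frag_of (?b e, e))"
    by (rule sum.subset_diff[OF sub E(1)])
  also have "(\<Sum>e\<in>E. frag_of (?b e, e)) = (\<Sum>e\<in>E. frag_of (b e, e))" by simp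
  finally have "(\<Sum>e\<in>E'. frag_of (?b e, e)) - (\<Sum>e\<in>E. frag_of (b e, e)) = (\<Sum>e\<in>E' - E. frag_of (?b e, e))"
    by simp
  also have "\<dots> \<in> ker" using E ker_zero_left by (intro ker_sum) auto
  finally have "c - (\<Sum>e\<in>E. frag_of (b e, e))
      - ((\<Sum>e\<in>E'. frag_of (?b e, e)) - (\<Sum>e\<in>E. frag_of (b e, e))) \<in> ker"
    using ker_diff[OF b(3)] by blast
  then have "c - (\<Sum>e\<in>E'. frag_of (?b e, e)) \<in> ker" by simp
  moreover have "?b \<in> E' \<rightarrow> carrier A" using b by auto
  ultimately show ?thesis unfolding spanned_def using b(1)
    by (intro CollectI conjI bexI[of _ ?b])
qed

definition pure_spanned where
  "pure_spanned E = {l \<in> carrier L. \<forall>a\<in>carrier A. frag_of (a, l) \<in> spanned E}"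

lemma pure_spanned_add:
  assumes E: "finite E" "E \<subseteq> carrier L" and l: "l \<in> pure_spanned E" and k: "k \<in> pure_spanned E"
  shows "l \<oplus>\<^bsub>L\<^esub> k \<in> pure_spanned E"
proof -
  have lk: "l \<in> carrier L" "k \<in> carrier L" using l k unfolding pure_spanned_def by auto
  have "frag_of (a, l \<oplus>\<^bsub>L\<^esub> k) \<in> spanned E" if a: "a \<in> carrier A" for a
  proof (rule spanned_cong[OF E])
    show "frag_of (a, l \<oplus>\<^bsub>L\<^esub> k) - (frag_of (a, l) + frag_of (a, k)) \<in> ker"
      using ker_right_add[OF a lk] by (simp add: algebra_simps)
    show "frag_of (a, l) + frag_of (a, k) \<in> spanned E"
      using l k a unfolding pure_spanned_def by (intro spanned_add[OF E]) auto
  qed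
  then show ?thesis unfolding pure_spanned_def using lk by auto
qed

lemma pure_spanned_scale:
  assumes E: "finite E" "E \<subseteq> carrier L" and l: "l \<in> pure_spanned E" and r: "r \<in> carrier R"
  shows "\<iota> r \<otimes>\<^bsub>L\<^esub> l \<in> pure_spanned E"
proof -
  have lc: "l \<in> carrier L" using l unfolding pure_spanned_def by auto
  have "frag_of (a, \<iota> r \<otimes>\<^bsub>L\<^esub> l) \<in> spanned E" if a: "a \<in> carrier A" for a
  proof (rule spanned_cong[OF E])
    show "frag_of (a, \<iota> r \<otimes>\<^bsub>L\<^esub> l) - frag_of (r \<odot>\<^bsub>A\<^esub> a, l) \<in> ker"
      using ker_minus[OF ker_smult[OF r a lc]] by simp
    show "frag_of (r \<odot>\<^bsub>A\<^esub> a, l) \<in> spanned E"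
      using l a r unfolding pure_spanned_def by auto
  qed
  then show ?thesis unfolding pure_spanned_def using lc r by auto
qed

lemma pure_spanned_generator:
  assumes E: "finite E" "E \<subseteq> carrier L" and e: "e \<in> E"
  shows "e \<in> pure_spanned E"
proof -
  have "frag_of (a, e) \<in> spanned E" if a: "a \<in> carrier A" for a
  proof (rule spanned_mono[OF E, of "{e}"])
    show "frag_of (a, e) \<in> spanned {e}"
      unfolding spanned_def using a e E FG_of ker_zero
      by (intro CollectI conjI bexI[of _ "\<lambda>_. a"]) auto
  qed (use e in auto)
  then show ?thesis unfolding pure_spanned_def using e E by auto
qed

lemma iota_minus: "r \<in> carrier R \<Longrightarrow> \<iota> (\<ominus> r) = \<ominus>\<^bsub>L\<^esub> \<iota> r"
proof -
  interpret h: ring_hom_cring R L \<iota>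
    by (intro ring_hom_cring.intro ring_hom_cring_axioms.intro iota R.is_cring L.is_cring)
  show "r \<in> carrier R \<Longrightarrow> \<iota> (\<ominus> r) = \<ominus>\<^bsub>L\<^esub> \<iota> r" by (rule h.hom_a_inv)
qed

lemma orthogonal_projection:
  assumes "orthogonal E" and x: "x \<in> carrier L"
  shows "\<exists>y\<in>pure_spanned E. \<forall>e\<in>E. tr ((x \<ominus>\<^bsub>L\<^esub> y) \<otimes>\<^bsub>L\<^esub> e) = \<zero>"
proof -
  have fin: "finite E" using assms(1) unfolding orthogonal_def by blast
  then show ?thesis
    using assms(1)
  proof (induction E)
    case empty
    have "\<zero>\<^bsub>L\<^esub> \<in> pure_spanned {}"
      unfolding pure_spanned_def using spanned_ker[of "{}"] ker_zero_right by auto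
    then show ?case by blast
  next
    case (insert e E)
    have E: "orthogonal E" "finite (insert e E)" "insert e E \<subseteq> carrier L" "e \<in> carrier L - {\<zero>\<^bsub>L\<^esub>}"
      "\<And>e'. e' \<in> E \<Longrightarrow> tr (e \<otimes>\<^bsub>L\<^esub> e') = \<zero>"
      using insert.prems insert.hyps unfolding orthogonal_def by auto
    from insert.IH[OF E(1)] obtain y where y: "y \<in> pure_spanned E"
      "\<And>e'. e' \<in> E \<Longrightarrow> tr ((x \<ominus>\<^bsub>L\<^esub> y) \<otimes>\<^bsub>L\<^esub> e') = \<zero>" by blast
    have yE: "y \<in> pure_spanned (insert e E)" "y \<in> carrier L"
      using y(1) spanned_mono[OF E(2,3), of E] unfolding pure_spanned_def by auto
    interpret Rf: field R by (rule field_R)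
    let ?t = "tr (e \<otimes>\<^bsub>L\<^esub> e)"
    have t: "?t \<in> carrier R" "inv ?t \<in> carrier R" "inv ?t \<otimes> ?t = \<one>"
      using tr_square[OF E(4)] E(4) Rf.field_Units by auto
    define r where "r = \<ominus> (tr ((x \<ominus>\<^bsub>L\<^esub> y) \<otimes>\<^bsub>L\<^esub> e) \<otimes> inv ?t)"
    have r: "r \<in> carrier R" unfolding r_def using x yE E t by simp
    define y' where "y' = y \<ominus>\<^bsub>L\<^esub> \<iota> r \<otimes>\<^bsub>L\<^esub> e"
    have y'E: "y' \<in> carrier L" unfolding y'_def using yE r E by simp
    have "y' = y \<oplus>\<^bsub>L\<^esub> \<iota> (\<ominus> r) \<otimes>\<^bsub>L\<^esub> e"
      unfolding y'_def using yE(2) r E(4) by (simp add: iota_minus L.minus_eq L.l_minus)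
    then have "y' \<in> pure_spanned (insert e E)"
      using pure_spanned_add[OF E(2,3) yE(1) pure_spanned_scale[OF E(2,3) pure_spanned_generator[OF E(2,3)]]]
        r by simp
    moreover have "tr ((x \<ominus>\<^bsub>L\<^esub> y') \<otimes>\<^bsub>L\<^esub> e') = \<zero>" if e': "e' \<in> insert e E" for e'
    proof -
      have e'c: "e' \<in> carrier L" and ec: "e \<in> carrier L" using e' E by auto
      have "(x \<ominus>\<^bsub>L\<^esub> y') \<otimes>\<^bsub>L\<^esub> e' = (x \<ominus>\<^bsub>L\<^esub> y) \<otimes>\<^bsub>L\<^esub> e' \<oplus>\<^bsub>L\<^esub> \<iota> r \<otimes>\<^bsub>L\<^esub> (e \<otimes>\<^bsub>L\<^esub> e')"
        unfolding y'_def using x yE(2) iota_closed[OF r] ec e'c by algebra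
      then have *: "tr ((x \<ominus>\<^bsub>L\<^esub> y') \<otimes>\<^bsub>L\<^esub> e')
          = tr ((x \<ominus>\<^bsub>L\<^esub> y) \<otimes>\<^bsub>L\<^esub> e') \<oplus> r \<otimes> tr (e \<otimes>\<^bsub>L\<^esub> e')"
        using x yE(2) r E(4) e'c by (simp add: tr_add tr_scale)
      show ?thesis
      proof (cases "e' = e")
        case False
        then show ?thesis using * y(2) E(5) e' r by auto
      next
        case True
        have s: "tr ((x \<ominus>\<^bsub>L\<^esub> y) \<otimes>\<^bsub>L\<^esub> e) \<in> carrier R" using x yE E by simp
        have "r \<otimes> ?t = \<ominus> tr ((x \<ominus>\<^bsub>L\<^esub> y) \<otimes>\<^bsub>L\<^esub> e)"
          unfolding r_def using s t by (simp add: R.l_minus R.m_assoc)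
        then show ?thesis using * True s by (simp add: R.r_neg)
      qed
    qed
    ultimately show ?case by blast
  qed
qed

lemma ex_orthogonal_spanning:
  assumes "finite Y" "Y \<subseteq> carrier L"
  shows "\<exists>E. orthogonal E \<and> Y \<subseteq> pure_spanned E"
  using assms
proof (induction Y)
  case empty
  show ?case unfolding orthogonal_def by blast
next
  case (insert x Y)
  then obtain E where E: "orthogonal E" "Y \<subseteq> pure_spanned E" and x: "x \<in> carrier L" by auto
  have fin: "finite E" "E \<subseteq> carrier L" using E(1) unfolding orthogonal_def by auto
  from orthogonal_projection[OF E(1) x] obtain y where
    y: "y \<in> pure_spanned E" "\<And>e. e \<in> E \<Longrightarrow> tr ((x \<ominus>\<^bsub>L\<^esub> y) \<otimes>\<^bsub>L\<^esub> e) = \<zero>" by blast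
  have yc: "y \<in> carrier L" using y(1) unfolding pure_spanned_def by blast
  define e where "e = x \<ominus>\<^bsub>L\<^esub> y"
  have ec: "e \<in> carrier L" and xe: "x = e \<oplus>\<^bsub>L\<^esub> y"
    unfolding e_def using x yc by (simp_all add: L.minus_eq L.a_assoc L.l_neg)
  show ?case
  proof (cases "e = \<zero>\<^bsub>L\<^esub>")
    case True
    then show ?thesis using xe yc y(1) E by auto
  next
    case False
    let ?E = "insert e E"
    have fin': "finite ?E" "?E \<subseteq> carrier L" using fin ec by auto
    have "tr (e' \<otimes>\<^bsub>L\<^esub> e) = \<zero>" if "e' \<in> E" for e'
      using y(2)[OF that] L.m_comm[OF ec, of e'] fin(2) that unfolding e_def by auto
    then have "orthogonal ?E"
      using E(1) y(2) False ec unfolding orthogonal_def e_def[symmetric] by auto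
    moreover have sub: "pure_spanned E \<subseteq> pure_spanned ?E"
      unfolding pure_spanned_def using spanned_mono[OF fin', of E] by auto
    moreover have "x \<in> pure_spanned ?E"
      unfolding xe using pure_spanned_add[OF fin' pure_spanned_generator[OF fin'] subsetD[OF sub y(1)]]
      by blast
    ultimately show ?thesis using E(2) by blast
  qed
qed

lemma ex_orthogonal_representation:
  assumes c: "c \<in> FG"
  shows "\<exists>E b. orthogonal E \<and> b \<in> E \<rightarrow> carrier A \<and> c - (\<Sum>e\<in>E. frag_of (b e, e)) \<in> ker"
proof -
  let ?Y = "snd ` Poly_Mapping.keys c"
  have "?Y \<subseteq> carrier L" using c by auto
  then obtain E where E: "orthogonal E" "?Y \<subseteq> pure_spanned E"
    using ex_orthogonal_spanning[of ?Y] by auto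
  have fin: "finite E" "E \<subseteq> carrier L" using E(1) unfolding orthogonal_def by auto
  have "Poly_Mapping.keys c \<subseteq> carrier A \<times> pure_spanned E" using c E(2) by fastforce
  then have "c \<in> spanned E"
  proof (induction c rule: frag_induction)
    case zero
    show ?case using spanned_ker[OF fin ker_zero] .
  next
    case (one x)
    then show ?case unfolding pure_spanned_def by auto
  next
    case (diff a b)
    then show ?case using spanned_add[OF fin _ spanned_minus[OF fin], of a b] by simp
  qed
  then show ?thesis unfolding spanned_def using E(1) by blast
qed

lemma trA_square_cone: "c \<in> FG \<Longrightarrow> trA_square c \<in> hermitian_cone"
  and trA_square_zero_ker:
    "\<lbrakk>\<not> weakly_isotropic A \<sigma>; c \<in> FG; trA_square c = \<zero>\<^bsub>A\<^esub>\<rbrakk> \<Longrightarrow> c \<in> ker"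
proof -
  have *: "trA_square c \<in> hermitian_cone \<and>
    (\<not> weakly_isotropic A \<sigma> \<longrightarrow> trA_square c = \<zero>\<^bsub>A\<^esub> \<longrightarrow> c \<in> ker)" if c: "c \<in> FG" for c
  proof -
    from ex_orthogonal_representation[OF c] obtain E b where
      E: "orthogonal E" "b \<in> E \<rightarrow> carrier A" and cd: "c - (\<Sum>e\<in>E. frag_of (b e, e)) \<in> ker" by blast
    let ?d = "\<Sum>e\<in>E. frag_of (b e, e)"
    have "?d \<in> FG" using E unfolding orthogonal_def by (intro combination_FG) auto
    then have "trA_square c = trA_square ?d" using trA_square_cong c cd by blast
    then show ?thesis
      using orthogonal_combination[OF E] ker_add[OF cd, of ?d] by auto
  qed
  show "c \<in> FG \<Longrightarrow> trA_square c \<in> hermitian_cone" using * by blast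
  show "\<lbrakk>\<not> weakly_isotropic A \<sigma>; c \<in> FG; trA_square c = \<zero>\<^bsub>A\<^esub>\<rbrakk> \<Longrightarrow> c \<in> ker" using * by blast
qed

theorem weakly_isotropic_descent:
  assumes "weakly_isotropic (base_change R A L \<iota>) (base_change_map R A L \<iota> \<sigma>)"
  shows "weakly_isotropic A \<sigma>"
proof (rule ccontr)
  assume an: "\<not> weakly_isotropic A \<sigma>"
  let ?B = "base_change R A L \<iota>"
  from assms obtain n :: nat and z where n: "n \<ge> 1" and z: "z \<in> {..<n} \<rightarrow> carrier ?B - {\<zero>\<^bsub>?B\<^esub>}"
    and zero: "(\<Oplus>\<^bsub>?B\<^esub>i\<in>{..<n}. base_change_map R A L \<iota> \<sigma> (z i) \<otimes>\<^bsub>?B\<^esub> z i) = \<zero>\<^bsub>?B\<^esub>"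
    unfolding weakly_isotropic_def by blast
  have "\<exists>c. c \<in> FG \<and> z i = coset c" if "i < n" for i
    using z that unfolding carrier_base_change by blast
  then obtain c where c: "\<And>i. i < n \<Longrightarrow> c i \<in> FG" "\<And>i. i < n \<Longrightarrow> z i = coset (c i)" by metis
  have sq: "mul (sg (c i)) (c i) \<in> FG" if "i < n" for i using c(1)[OF that] mul_FG sg_FG by blast
  interpret B: abelian_monoid ?B by (rule abelian_monoid_base_change)
  have "(\<Oplus>\<^bsub>?B\<^esub>i\<in>{..<n}. base_change_map R A L \<iota> \<sigma> (z i) \<otimes>\<^bsub>?B\<^esub> z i)
      = (\<Oplus>\<^bsub>?B\<^esub>i\<in>{..<n}. coset (mul (sg (c i)) (c i)))"
    using c sq sg_FG
    by (intro B.finsum_cong')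
      (auto simp: base_change_map_coset mult_base_change carrier_base_change
        simp del: carrier_free_Abelian_group_iff)
  also have "\<dots> = coset (\<Sum>i\<in>{..<n}. mul (sg (c i)) (c i))"
    using sq by (intro finsum_base_change) auto
  finally have "(\<Sum>i\<in>{..<n}. mul (sg (c i)) (c i)) \<in> ker"
    using zero coset_self[of "\<Sum>i\<in>{..<n}. mul (sg (c i)) (c i)"] unfolding zero_base_change by simp
  then have sum: "(\<Oplus>\<^bsub>A\<^esub>i\<in>{..<n}. trA_square (c i)) = \<zero>\<^bsub>A\<^esub>"
    using trA_ker trA_sum[of "{..<n}" "\<lambda>i. mul (sg (c i)) (c i)"] sq by simp
  have "trA_square (c 0) = \<zero>\<^bsub>A\<^esub>"
    using n c(1) trA_square_cone
    by (intro hermitian_cone_finsum_eq_zero[OF an _ _ sum]) (auto simp del: carrier_free_Abelian_group_iff)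
  then have "c 0 \<in> ker" using trA_square_zero_ker[OF an c(1)] n by simp
  then have "z 0 = \<zero>\<^bsub>?B\<^esub>"
    using c(2)[of 0] n coset_eq[of "c 0" 0] coset_zero unfolding zero_base_change by simp
  then show False using z n by auto
qed

end

section \<open>The trace form of a Galois extension\<close>

lemma (in cring) semiordering_sum_squares:
  assumes S: "semiordering R S" and s: "s \<in> sum_squares R"
  shows "s \<in> S"
proof -
  have "quadratic_module R S"
    using S unfolding semiordering_def quadratic_module_def
    by (elim conjE) (intro conjI; assumption)
  then have "s \<otimes> \<one> \<in> S"
    using quadratic_module_sum_squares_mult[OF _ s] quadratic_moduleD(2) by blast
  then show ?thesis using s sum_squares_closed by simp
qed

lemma (in cring) finsum_squares:
  assumes "finite I" "x \<in> I \<rightarrow> carrier R"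
  shows "(\<Oplus>i\<in>I. x i \<otimes> x i) \<in> sum_squares R"
  using assms
proof (induction I)
  case empty
  show ?case using sum_squares.zero by simp
next
  case (insert i I)
  then have "(\<Oplus>i\<in>insert i I. x i \<otimes> x i) = x i \<otimes> x i \<oplus> (\<Oplus>i\<in>I. x i \<otimes> x i)"
    by (intro finsum_insert) (auto simp: Pi_def)
  then show ?case using insert sum_squares.add[of "x i" R] by simp
qed

lemma formally_real_square_add_nonzero:
  assumes real: "formally_real R" and x: "x \<in> carrier R" "x \<noteq> \<zero>\<^bsub>R\<^esub>" and s: "s \<in> sum_squares R"
  shows "x \<otimes>\<^bsub>R\<^esub> x \<oplus>\<^bsub>R\<^esub> s \<noteq> \<zero>\<^bsub>R\<^esub>"
proof
  interpret field R using formally_realD(1)[OF real] .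
  assume z: "x \<otimes>\<^bsub>R\<^esub> x \<oplus>\<^bsub>R\<^esub> s = \<zero>\<^bsub>R\<^esub>"
  have sc: "s \<in> carrier R" using s sum_squares_closed by blast
  have inv: "inv\<^bsub>R\<^esub> x \<in> carrier R" "inv\<^bsub>R\<^esub> x \<otimes>\<^bsub>R\<^esub> x = \<one>\<^bsub>R\<^esub>" using x field_Units by auto
  have "s = \<ominus>\<^bsub>R\<^esub> (x \<otimes>\<^bsub>R\<^esub> x)"
    using z x sc minus_equality[of s "x \<otimes>\<^bsub>R\<^esub> x"] a_comm[of s] by simp
  then have "(inv\<^bsub>R\<^esub> x \<otimes>\<^bsub>R\<^esub> inv\<^bsub>R\<^esub> x) \<otimes>\<^bsub>R\<^esub> s
      = \<ominus>\<^bsub>R\<^esub> ((inv\<^bsub>R\<^esub> x \<otimes>\<^bsub>R\<^esub> x) \<otimes>\<^bsub>R\<^esub> (inv\<^bsub>R\<^esub> x \<otimes>\<^bsub>R\<^esub> x))"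
    using inv(1) x(1) by algebra
  then have "(inv\<^bsub>R\<^esub> x \<otimes>\<^bsub>R\<^esub> inv\<^bsub>R\<^esub> x) \<otimes>\<^bsub>R\<^esub> s = \<ominus>\<^bsub>R\<^esub> \<one>\<^bsub>R\<^esub>" using inv by simp
  then show False
    using sum_squares_mult[OF square_in_sum_squares[OF inv(1)] s] formally_realD(2)[OF real] by simp
qed

definition galois_trace :: "('a, 'm) ring_scheme \<Rightarrow> 'a set \<Rightarrow> 'a \<Rightarrow> 'a" where
  "galois_trace K F k = (\<Oplus>\<^bsub>K\<^esub>\<tau>\<in>carrier (galois_group K F). \<tau> k)"

locale finite_galois_group = field K for K (structure) +
  fixes F
  assumes galois: "finite_galois K F"
    and finite_group: "finite (carrier (galois_group K F))"
begin

abbreviation "Gal \<equiv> carrier (galois_group K F)"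

lemma Gal_iff: "\<tau> \<in> Gal \<longleftrightarrow> \<tau> \<in> ring_hom K K \<and> \<tau> \<in> Bij (carrier K) \<and> (\<forall>x\<in>F. \<tau> x = x)"
  unfolding galois_group_def by auto

lemma Gal_hom:
  assumes "\<tau> \<in> Gal"
  shows "x \<in> carrier K \<Longrightarrow> \<tau> x \<in> carrier K"
    "\<lbrakk>x \<in> carrier K; y \<in> carrier K\<rbrakk> \<Longrightarrow> \<tau> (x \<oplus> y) = \<tau> x \<oplus> \<tau> y"
    "\<lbrakk>x \<in> carrier K; y \<in> carrier K\<rbrakk> \<Longrightarrow> \<tau> (x \<otimes> y) = \<tau> x \<otimes> \<tau> y"
    "x \<in> F \<Longrightarrow> \<tau> x = x"
  using assms ring_hom_closed ring_hom_add ring_hom_mult unfolding Gal_iff by metis+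

lemma subfield: "subfield F K" and fixed_field: "{x \<in> carrier K. \<forall>\<tau>\<in>Gal. \<tau> x = x} = F"
  using galois unfolding finite_galois_def by auto

lemma F_carrier: "x \<in> F \<Longrightarrow> x \<in> carrier K"
  using subfieldE(3)[OF subfield] by blast

lemma Gal_id: "(\<lambda>x\<in>carrier K. x) \<in> Gal"
  unfolding Gal_iff Bij_def using F_carrier
  by (auto intro!: ring_hom_memI simp: bij_betw_def inj_on_def)

lemma Gal_compose:
  assumes \<rho>: "\<rho> \<in> Gal" and \<tau>: "\<tau> \<in> Gal"
  shows "compose (carrier K) \<rho> \<tau> \<in> Gal"
proof -
  have "compose (carrier K) \<rho> \<tau> \<in> ring_hom K K"
  proof (rule ring_hom_memI)
    have "\<rho> \<one> = \<one>" "\<tau> \<one> = \<one>" using \<rho> \<tau> unfolding Gal_iff by (auto intro: ring_hom_one)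
    then show "compose (carrier K) \<rho> \<tau> \<one> = \<one>" by (simp add: compose_eq)
  qed (simp_all add: compose_eq Gal_hom[OF \<rho>] Gal_hom[OF \<tau>])
  moreover have "compose (carrier K) \<rho> \<tau> \<in> Bij (carrier K)"
    using \<rho> \<tau> unfolding Gal_iff by (blast intro: compose_Bij)
  moreover have "compose (carrier K) \<rho> \<tau> x = x" if "x \<in> F" for x
    using that F_carrier by (simp add: compose_eq Gal_hom(4)[OF \<rho>] Gal_hom(4)[OF \<tau>])
  ultimately show ?thesis unfolding Gal_iff by blast
qed

lemma Gal_permute:
  assumes \<tau>: "\<tau> \<in> Gal"
  shows "inj_on (compose (carrier K) \<tau>) Gal" "compose (carrier K) \<tau> ` Gal = Gal"
proof -
  show inj: "inj_on (compose (carrier K) \<tau>) Gal"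
  proof
    fix \<rho> \<rho>' assume \<rho>: "\<rho> \<in> Gal" "\<rho>' \<in> Gal" and eq: "compose (carrier K) \<tau> \<rho> = compose (carrier K) \<tau> \<rho>'"
    have "\<rho> x = \<rho>' x" if x: "x \<in> carrier K" for x
    proof -
      have "\<tau> (\<rho> x) = \<tau> (\<rho>' x)" using fun_cong[OF eq, of x] x by (simp add: compose_eq)
      moreover have "inj_on \<tau> (carrier K)" using \<tau> unfolding Gal_iff Bij_def bij_betw_def by blast
      ultimately show ?thesis using Gal_hom(1) \<rho> x by (metis inj_onD)
    qed
    moreover have "\<rho> \<in> extensional (carrier K)" "\<rho>' \<in> extensional (carrier K)"
      using \<rho> unfolding Gal_iff Bij_def by blast+
    ultimately show "\<rho> = \<rho>'" by (metis extensionalityI)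
  qed
  show "compose (carrier K) \<tau> ` Gal = Gal"
    using Gal_compose[OF \<tau>] by (intro endo_inj_surj[OF finite_group _ inj]) auto
qed

lemma Gal_finsum:
  assumes \<tau>: "\<tau> \<in> Gal" and "finite I" "f \<in> I \<rightarrow> carrier K"
  shows "\<tau> (\<Oplus>i\<in>I. f i) = (\<Oplus>i\<in>I. \<tau> (f i))"
proof -
  interpret h: ring_hom_cring K K \<tau>
    using \<tau> by (intro ring_hom_cring.intro ring_hom_cring_axioms.intro is_cring) (simp add: Gal_iff)
  show ?thesis using h.hom_finsum[of f I] assms(3) by (simp add: comp_def)
qed

lemma galois_trace_closed: 
  assumes k: "k \<in> carrier K"
  shows "galois_trace K F k \<in> F"
proof -
  have c: "(\<lambda>\<tau>. \<tau> k) \<in> Gal \<rightarrow> carrier K" using Gal_hom(1) k by blast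
  have "\<tau> (galois_trace K F k) = galois_trace K F k" if \<tau>: "\<tau> \<in> Gal" for \<tau>
  proof -
    have "\<tau> (galois_trace K F k) = (\<Oplus>\<rho>\<in>Gal. \<tau> (\<rho> k))"
      unfolding galois_trace_def using Gal_finsum[OF \<tau> finite_group c] .
    also have "\<dots> = (\<Oplus>\<rho>\<in>Gal. compose (carrier K) \<tau> \<rho> k)"
      using k by (simp add: compose_eq)
    also have "\<dots> = (\<Oplus>\<rho>\<in>compose (carrier K) \<tau> ` Gal. \<rho> k)"
      using c Gal_permute[OF \<tau>] by (intro finsum_reindex[symmetric]) auto
    finally show ?thesis unfolding Gal_permute(2)[OF \<tau>] galois_trace_def .
  qed
  moreover have "galois_trace K F k \<in> carrier K"
    unfolding galois_trace_def using finsum_closed[OF c] .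
  ultimately show ?thesis using fixed_field by blast
qed

lemma galois_trace_add:
  assumes "k \<in> carrier K" "l \<in> carrier K"
  shows "galois_trace K F (k \<oplus> l) = galois_trace K F k \<oplus> galois_trace K F l"
proof -
  have c: "(\<lambda>\<tau>. \<tau> k) \<in> Gal \<rightarrow> carrier K" "(\<lambda>\<tau>. \<tau> l) \<in> Gal \<rightarrow> carrier K"
    using Gal_hom(1) assms by auto
  have "galois_trace K F (k \<oplus> l) = (\<Oplus>\<tau>\<in>Gal. \<tau> k \<oplus> \<tau> l)"
    unfolding galois_trace_def using assms Gal_hom(1,2) by (intro finsum_cong') auto
  then show ?thesis unfolding galois_trace_def using finsum_addf[OF c] by simp
qed

lemma galois_trace_scale:
  assumes "r \<in> F" "k \<in> carrier K"
  shows "galois_trace K F (r \<otimes> k) = r \<otimes> galois_trace K F k"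
proof -
  have c: "(\<lambda>\<tau>. \<tau> k) \<in> Gal \<rightarrow> carrier K" using Gal_hom(1) assms by auto
  have "galois_trace K F (r \<otimes> k) = (\<Oplus>\<tau>\<in>Gal. r \<otimes> \<tau> k)"
    unfolding galois_trace_def using c F_carrier[OF assms(1)] assms
    by (intro finsum_cong') (auto simp: Gal_hom)
  then show ?thesis
    unfolding galois_trace_def using finsum_rdistr[OF finite_group F_carrier[OF assms(1)] c] by simp
qed

lemma galois_trace_square:
  assumes tp: "totally_positive K F" and l: "l \<in> carrier K" "l \<noteq> \<zero>"
  shows "galois_trace K F (l \<otimes> l) \<in> sum_squares (K\<lparr>carrier := F\<rparr>)" "galois_trace K F (l \<otimes> l) \<noteq> \<zero>"
proof -
  have real: "formally_real (K\<lparr>carrier := F\<rparr>)" "formally_real K"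
    using tp unfolding totally_positive_def by auto
  let ?id = "\<lambda>x\<in>carrier K. x" and ?t = "galois_trace K F (l \<otimes> l)"
  have c: "(\<lambda>\<tau>. \<tau> l) \<in> Gal \<rightarrow> carrier K" using Gal_hom(1) l by blast
  have t: "?t = (\<Oplus>\<tau>\<in>Gal. \<tau> l \<otimes> \<tau> l)"
    unfolding galois_trace_def using l Gal_hom(1,3) by (intro finsum_cong') auto
  have "(\<Oplus>\<tau>\<in>insert ?id (Gal - {?id}). \<tau> l \<otimes> \<tau> l)
      = ?id l \<otimes> ?id l \<oplus> (\<Oplus>\<tau>\<in>Gal - {?id}. \<tau> l \<otimes> \<tau> l)"
    using finite_group c l by (intro finsum_insert) auto
  then have "?t = l \<otimes> l \<oplus> (\<Oplus>\<tau>\<in>Gal - {?id}. \<tau> l \<otimes> \<tau> l)"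
    unfolding t using l Gal_id by (simp add: insert_absorb)
  moreover have "(\<Oplus>\<tau>\<in>Gal - {?id}. \<tau> l \<otimes> \<tau> l) \<in> sum_squares K"
    using finite_group c by (intro finsum_squares) auto
  ultimately show "?t \<noteq> \<zero>"
    using formally_real_square_add_nonzero[OF real(2) l] by simp
  have tK: "?t \<in> sum_squares K" unfolding t using finsum_squares[OF finite_group c] .
  show "?t \<in> sum_squares (K\<lparr>carrier := F\<rparr>)"
  proof (rule ccontr)
    assume "?t \<notin> sum_squares (K\<lparr>carrier := F\<rparr>)"
    moreover have tF: "?t \<in> F" using galois_trace_closed l by simp
    ultimately obtain S where S: "semiordering (K\<lparr>carrier := F\<rparr>) S" "?t \<notin> S"
      using not_sum_squares_semiordering[OF real(1), of ?t] by auto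
    then obtain S' where "semiordering K S'" "S' \<inter> F = S"
      using tp unfolding totally_positive_def by blast
    then show False using semiordering_sum_squares[OF _ tK] tF S(2) by blast
  qed
qed

end

theorem theorem1p2:
  fixes K :: "'k ring" and F :: "'k set"
    and A :: "('k, 'a) module" and \<sigma> :: "'a \<Rightarrow> 'a"
  assumes "finite_galois_2_extension K F"
    and "formally_real (K\<lparr>carrier := F\<rparr>)" and "formally_real K"
    and "totally_positive K F"
    and "central_simple_algebra (K\<lparr>carrier := F\<rparr>) A"
    and "orthogonal_involution (K\<lparr>carrier := F\<rparr>) A \<sigma>"
    and "weakly_isotropic (base_change (K\<lparr>carrier := F\<rparr>) A K (\<lambda>x. x))
           (base_change_map (K\<lparr>carrier := F\<rparr>) A K (\<lambda>x. x) \<sigma>)"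
  shows "weakly_isotropic A \<sigma>"
proof -
  have galois: "finite_galois K F" using assms(1) unfolding finite_galois_2_extension_def by blast
  obtain n :: nat where "order (galois_group K F) = 2 ^ n"
    using assms(1) unfolding finite_galois_2_extension_def by blast
  then have "card (carrier (galois_group K F)) > 0" unfolding order_def by simp
  then have fin: "finite (carrier (galois_group K F))" by (rule card_ge_0_finite)
  have field: "field K" using assms(3) by (rule formally_realD(1))
  interpret G: finite_galois_group K F
    by (intro finite_galois_group.intro finite_galois_group_axioms.intro field galois fin)
  have "assoc_algebra (K\<lparr>carrier := F\<rparr>) A"
    using assms(5) unfolding central_simple_algebra_def by blast
  moreover have "involution (K\<lparr>carrier := F\<rparr>) A \<sigma>"
    using assms(6) unfolding orthogonal_involution_def by blast
  ultimately have "algebra_with_involution (K\<lparr>carrier := F\<rparr>) A \<sigma>"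
    by (intro algebra_with_involution.intro algebra_with_involution_axioms.intro)
  moreover have "trace_descent_axioms (K\<lparr>carrier := F\<rparr>) K (\<lambda>x. x) (galois_trace K F)"
  proof (rule trace_descent_axioms.intro)
    show "field (K\<lparr>carrier := F\<rparr>)" using assms(2) by (rule formally_realD(1))
    show "(\<lambda>x. x) \<in> ring_hom (K\<lparr>carrier := F\<rparr>) K"
      using G.F_carrier by (intro ring_hom_memI) simp_all
    show "galois_trace K F (l \<otimes>\<^bsub>K\<^esub> l) \<in> sum_squares (K\<lparr>carrier := F\<rparr>) - {\<zero>\<^bsub>K\<lparr>carrier := F\<rparr>\<^esub>}"
      if "l \<in> carrier K - {\<zero>\<^bsub>K\<^esub>}" for l
      using G.galois_trace_square[OF assms(4)] that by simp
  qed (simp_all add: G.galois_trace_closed G.galois_trace_add G.galois_trace_scale)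
  ultimately interpret trace_descent "K\<lparr>carrier := F\<rparr>" A \<sigma> K "\<lambda>x. x" "galois_trace K F"
    using field by (intro trace_descent.intro)
  show ?thesis using assms(7) by (rule weakly_isotropic_descent)
qed

end
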